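(* Let $\phi:\Omega\to\mathbb{R}$ satisfy the standing assumptions listed in the context, let $S=\{(x,\phi(x)):x\in\Omega\}$ with surface measure $\mathrm{d}\sigma$, and let $\rho\ge 0$ be a smooth compactly supported function on $S$ with $\rho(0)\neq 0$. Let $p=(p_1,p_3)\in[1,\infty]^2$ and assume that there is a constant $C_p$ such that $$\Big(\int |\widehat f|^2\rho\,\mathrm{d}\sigma\Big)^{1/2}\le C_p\,\|f\|_{L^{p_3}_{x_3}(L^{p_1}_{(x_1,x_2)})}\qquad\text{for all } f\in\mathcal S(\mathbb{R}^3).$$ If $\phi$ is adapted, then necessarily $$\frac{1}{d(\phi)\,p_1'}+\frac1{p_3'}\le\frac1{2d(\phi)}.$$ If $\phi$ is linearly adapted but not adapted, and $K$, $m$ and $\mathcal L$ are as defined in the context, then necessarily $$\frac1{p_3'}\le-\frac12\,\mathcal L(K)\Big[\frac{2+2m}{p_1'}-1\Big].$$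
   Context: **Mixed norm.** $\|f\|_{L^{p_3}_{x_3}(L^{p_1}_{(x_1,x_2)})}=\big(\int(\iint|f(x_1,x_2,x_3)|^{p_1}\mathrm{d}x_1\mathrm{d}x_2)^{p_3/p_1}\mathrm{d}x_3\big)^{1/p_3}$ (usual modifications for $\infty$); $p_i'$ is the Hölder conjugate of $p_i$. **Newton polyhedra.** A smooth $\phi$ is of finite type at a point if some partial derivative $\partial^\alpha\phi$ ($\alpha\in\mathbb{N}_0^2$) does not vanish there. The Newton polyhedron $\mathcal N(\phi)$ is the convex hull of $\bigcup_\alpha\{(t_1,t_2):t_1\ge\alpha_1,t_2\ge\alpha_2\}$, the union being over all $\alpha$ with $\partial^\alpha\phi(0)\ne0$. Its edges (compact or unbounded) and vertices are its faces. The principal face $\pi(\phi)$ is the face of minimal dimension intersecting the bisectrix $\{t_1=t_2\}$; the Newton distance $d(\phi)$ is the number $d$ such that $(d,d)$ is the intersection point of the bisectrix and the principal face. The height is $h(\phi)=\sup d(\phi\circ\varphi)$ over all smooth local coordinate changes $\varphi$ (smooth and invertible near $0$, $\varphi(0)=0$), and the linear height $h_{\mathrm{lin}}(\phi)$ is the same supremum over linear coordinate changes. $\phi$ is adapted if $d(\phi)=h(\phi)$ and linearly adapted if $d(\phi)=h_{\mathrm{lin}}(\phi)$; coordinates $y$ are adapted if the Newton distance of $\phi$ expressed in the coordinates $y$ equals $h(\phi)$. For a weight $\kappa=(\kappa_1,\kappa_2)\in[0,\infty)^2$ put $L_\kappa=\{(t_1,t_2)\in\mathbb{R}^2:\kappa_1t_1+\kappa_2t_2=1\}$.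 From now on $\kappa$ denotes the weight such that $L_\kappa$ contains $\pi(\phi)$ if $\pi(\phi)$ is an edge, and such that $L_\kappa$ contains the edge of $\mathcal N(\phi)$ having $\pi(\phi)$ as its left endpoint if $\pi(\phi)$ is a vertex. Put $m=\kappa_2/\kappa_1$. **Standing assumptions on $\phi$.** $\phi$ is real-valued and smooth on a sufficiently small open neighbourhood $\Omega$ of $0$ in $\mathbb{R}^2$; $\phi(0)=0$, $\nabla\phi(0)=0$; $\phi$ is of finite type on $\Omega$; $\kappa_2/\kappa_1\ge1$; and the original coordinates $x$ are either adapted, or linearly adapted but not adapted (in both cases $d(\phi)=h_{\mathrm{lin}}(\phi)$). **Non-adapted case.** If $\phi$ is not adapted (and linearly adapted), then $m\ge2$ is an integer and Varchenko's algorithm yields a smooth real-valued function $\psi$, $\psi(x_1)=b_1x_1^m+\mathcal O(x_1^{m+1})$, $b_1\ne0$ (the principal root jet of $\phi$), such that $y_1=x_1$, $y_2=x_2-\psi(x_1)$ are adapted coordinates. Put $\phi^a(y_1,y_2)=\phi(y_1,y_2+\psi(y_1))$. Let $P=(t_1^P,t_2^P)$ be the point of $L_\kappa\cap\mathcal N(\phi^a)$ with smallest $t_2$-coordinate, and $L^+=\{(t_1,t_2)\in L_\kappa:t_2\ge t_2^P\}$. The augmented Newton polyhedron $\mathcal N^{\mathrm{res}}(\phi^a)$ is the convex hull of $\mathcal N(\phi^a)\cup L^+$. The function $K:[0,\kappa_1]\to[0,+\infty]$ is defined as follows: for each $\tilde\kappa_1\in[0,\kappa_1]$, $K(\tilde\kappa_1)$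 is the unique $\tilde\kappa_2$ for which $L_{\tilde\kappa}$, $\tilde\kappa=(\tilde\kappa_1,\tilde\kappa_2)$, is a supporting line to $\mathcal N^{\mathrm{res}}(\phi^a)$ (with value $+\infty$ at $\tilde\kappa_1=0$ if the horizontal unbounded edge lies on $t_2=0$). Its Legendre transform is $\mathcal L(K)[w]=\sup_{u\in[0,\kappa_1]}(wu-K(u))$. *)

theory Defs
  imports
    "HOL-Analysis.Analysis"
    "HOL-Probability.Essential_Supremum"
    "HOL-Library.Landau_Symbols"
begin

section \<open>Smooth functions\<close>

definition dir_deriv ::
  "'a::euclidean_space \<Rightarrow> ('a \<Rightarrow> 'b::real_normed_vector) \<Rightarrow> 'a \<Rightarrow> 'b"
  where "dir_deriv v f = (\<lambda>x. frechet_derivative f (at x) v)"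

text \<open>The following notions are meant for open \<open>S\<close>.\<close>

primrec ck_on ::
  "nat \<Rightarrow> 'a::euclidean_space set \<Rightarrow> ('a \<Rightarrow> 'b::real_normed_vector) \<Rightarrow> bool"
  where
    "ck_on 0 S f \<longleftrightarrow> continuous_on S f"
  | "ck_on (Suc k) S f \<longleftrightarrow>
       (\<forall>x\<in>S. f differentiable (at x)) \<and> (\<forall>v. ck_on k S (dir_deriv v f))"

definition smooth_on ::
  "'a::euclidean_space set \<Rightarrow> ('a \<Rightarrow> 'b::real_normed_vector) \<Rightarrow> bool"
  where "smooth_on S f \<longleftrightarrow> (\<forall>k. ck_on k S f)"

definition partial_deriv ::
  "nat \<times> nat \<Rightarrow> (real \<times> real \<Rightarrow> real) \<Rightarrow> real \<times> real \<Rightarrow> real"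
  where "partial_deriv \<alpha> f =
    (dir_deriv (1, 0) ^^ fst \<alpha>) ((dir_deriv (0, 1) ^^ snd \<alpha>) f)"

definition finite_type_at :: "(real \<times> real \<Rightarrow> real) \<Rightarrow> real \<times> real \<Rightarrow> bool"
  where "finite_type_at f x \<longleftrightarrow> (\<exists>\<alpha>. partial_deriv \<alpha> f x \<noteq> 0)"

section \<open>Newton polyhedra\<close>

definition newton_polyhedron :: "(real \<times> real \<Rightarrow> real) \<Rightarrow> (real \<times> real) set"
  where "newton_polyhedron f = convex hull
    (\<Union>\<alpha>\<in>{\<alpha>. partial_deriv \<alpha> f 0 \<noteq> 0}.
       {(t1, t2). t1 \<ge> real (fst \<alpha>) \<and> t2 \<ge> real (snd \<alpha>)})"

definition is_vertex :: "(real \<times> real) set \<Rightarrow> (real \<times> real) set \<Rightarrow> bool"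
  where "is_vertex F N \<longleftrightarrow> F face_of N \<and> aff_dim F = 0"

definition is_edge :: "(real \<times> real) set \<Rightarrow> (real \<times> real) set \<Rightarrow> bool"
  where "is_edge F N \<longleftrightarrow> F face_of N \<and> aff_dim F = 1"

definition meets_bisectrix :: "(real \<times> real) set \<Rightarrow> bool"
  where "meets_bisectrix F \<longleftrightarrow> (\<exists>t. (t, t) \<in> F)"

text \<open>The empty face and the improper two-dimensional face, which are faces in the
  sense of \<^const>\<open>face_of\<close>, do not count here.\<close>

definition is_principal_face :: "(real \<times> real) set \<Rightarrow> (real \<times> real) set \<Rightarrow> bool"
  where "is_principal_face F N \<longleftrightarrow>
    (is_vertex F N \<or> is_edge F N) \<and> meets_bisectrix F \<and>
    (\<forall>G. (is_vertex G N \<or> is_edge G N) \<and> meets_bisectrix G \<longrightarrow> aff_dim F \<le> aff_dim G)"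

definition newton_distance :: "(real \<times> real \<Rightarrow> real) \<Rightarrow> real"
  where "newton_distance f =
    (THE d. \<exists>F. is_principal_face F (newton_polyhedron f) \<and> (d, d) \<in> F)"

definition local_coordinate_change :: "(real \<times> real \<Rightarrow> real \<times> real) \<Rightarrow> bool"
  where "local_coordinate_change F \<longleftrightarrow> F 0 = 0 \<and>
    (\<exists>U V G. open U \<and> 0 \<in> U \<and> open V \<and> F ` U = V \<and>
       smooth_on U F \<and> smooth_on V G \<and> (\<forall>x\<in>U. G (F x) = x))"

text \<open>For \<open>f\<close> of finite type at \<open>0\<close> the two suprema are over nonempty sets that are
  bounded by the order of vanishing of \<open>f\<close> at \<open>0\<close>, so the real supremum is the right one.\<close>

definition height :: "(real \<times> real \<Rightarrow> real) \<Rightarrow> real"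
  where "height f = (SUP F\<in>{F. local_coordinate_change F}. newton_distance (f \<circ> F))"

definition linear_height :: "(real \<times> real \<Rightarrow> real) \<Rightarrow> real"
  where "linear_height f = (SUP F\<in>{F. linear F \<and> bij F}. newton_distance (f \<circ> F))"

definition adapted :: "(real \<times> real \<Rightarrow> real) \<Rightarrow> bool"
  where "adapted f \<longleftrightarrow> newton_distance f = height f"

definition linearly_adapted :: "(real \<times> real \<Rightarrow> real) \<Rightarrow> bool"
  where "linearly_adapted f \<longleftrightarrow> newton_distance f = linear_height f"

definition weight_line :: "real \<times> real \<Rightarrow> (real \<times> real) set"
  where "weight_line \<kappa> = {(t1, t2). fst \<kappa> * t1 + snd \<kappa> * t2 = 1}"

text \<open>Strictness in the definition of a left endpoint rules out that the corner of the
  vertical unbounded edge counts as its left endpoint.\<close>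

definition is_left_endpoint :: "real \<times> real \<Rightarrow> (real \<times> real) set \<Rightarrow> bool"
  where "is_left_endpoint v E \<longleftrightarrow> v \<in> E \<and> (\<forall>t\<in>E. t \<noteq> v \<longrightarrow> fst v < fst t)"

definition is_principal_weight :: "(real \<times> real \<Rightarrow> real) \<Rightarrow> real \<times> real \<Rightarrow> bool"
  where "is_principal_weight f \<kappa> \<longleftrightarrow> 0 \<le> fst \<kappa> \<and> 0 \<le> snd \<kappa> \<and>
    (\<exists>F. is_principal_face F (newton_polyhedron f) \<and>
       (is_edge F (newton_polyhedron f) \<longrightarrow> F \<subseteq> weight_line \<kappa>) \<and>
       (is_vertex F (newton_polyhedron f) \<longrightarrow>
          (\<exists>v E. F = {v} \<and> is_edge E (newton_polyhedron f) \<and>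
             is_left_endpoint v E \<and> E \<subseteq> weight_line \<kappa>)))"

section \<open>The non-adapted case\<close>

definition root_coordinates ::
  "(real \<times> real \<Rightarrow> real) \<Rightarrow> (real \<Rightarrow> real) \<Rightarrow> real \<times> real \<Rightarrow> real"
  where "root_coordinates f \<psi> = (\<lambda>(y1, y2). f (y1, y2 + \<psi> y1))"

text \<open>Only the properties of the root jet that make \<open>y\<^sub>1 = x\<^sub>1\<close>, \<open>y\<^sub>2 = x\<^sub>2 - \<psi> x\<^sub>1\<close> adapted
  coordinates are recorded; they hold for the function produced by Varchenko's algorithm but
  need not determine it.\<close>

definition is_principal_root_jet ::
  "(real \<times> real \<Rightarrow> real) \<Rightarrow> real \<times> real \<Rightarrow> (real \<Rightarrow> real) \<Rightarrow> bool"
  where "is_principal_root_jet f \<kappa> \<psi> \<longleftrightarrow>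
    (\<exists>U. open U \<and> 0 \<in> U \<and> smooth_on U \<psi>) \<and>
    (\<exists>(m::nat) b1. real m = snd \<kappa> / fst \<kappa> \<and> 2 \<le> m \<and> b1 \<noteq> 0 \<and>
       (\<lambda>x. \<psi> x - b1 * x ^ m) \<in> O[at 0](\<lambda>x. x ^ (m + 1))) \<and>
    newton_distance (root_coordinates f \<psi>) = height f"

definition lowest_point ::
  "real \<times> real \<Rightarrow> (real \<times> real) set \<Rightarrow> real \<times> real"
  where "lowest_point \<kappa> N =
    (THE P. P \<in> weight_line \<kappa> \<inter> N \<and> (\<forall>t\<in>weight_line \<kappa> \<inter> N. snd P \<le> snd t))"

definition augmented_newton_polyhedron ::
  "real \<times> real \<Rightarrow> (real \<times> real \<Rightarrow> real) \<Rightarrow> (real \<times> real) set"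
  where "augmented_newton_polyhedron \<kappa> g = convex hull
    (newton_polyhedron g \<union>
     {t \<in> weight_line \<kappa>. snd (lowest_point \<kappa> (newton_polyhedron g)) \<le> snd t})"

definition is_supporting_weight :: "real \<times> real \<Rightarrow> (real \<times> real) set \<Rightarrow> bool"
  where "is_supporting_weight \<kappa> A \<longleftrightarrow> weight_line \<kappa> \<inter> A \<noteq> {} \<and>
    ((\<forall>(t1, t2)\<in>A. fst \<kappa> * t1 + snd \<kappa> * t2 \<ge> 1) \<or>
     (\<forall>(t1, t2)\<in>A. fst \<kappa> * t1 + snd \<kappa> * t2 \<le> 1))"

text \<open>The infimum is taken in \<^typ>\<open>ereal\<close>. If there is exactly one \<open>k\<close> such that the line
  of weight \<open>(u, k)\<close> supports \<open>A\<close>, it is the value. If the horizontal unbounded edge of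
  \<open>A\<close> is \<open>[a, \<infinity>) \<times> {0}\<close>, there is no such \<open>k\<close> for \<open>0 \<le> u < 1 / a\<close> and the value
  is \<open>\<infinity>\<close>; for \<open>u = 1 / a\<close> all sufficiently large \<open>k\<close> occur and the value is the least one.\<close>

definition support_function :: "(real \<times> real) set \<Rightarrow> real \<Rightarrow> ereal"
  where "support_function A u =
    Inf {ereal k | k. 0 \<le> k \<and> is_supporting_weight (u, k) A}"

definition legendre :: "real \<Rightarrow> (real \<Rightarrow> ereal) \<Rightarrow> real \<Rightarrow> ereal"
  where "legendre b K w = (SUP u\<in>{0..b}. ereal (w * u) - K u)"

section \<open>Fourier restriction\<close>

definition schwartz :: "('a::euclidean_space \<Rightarrow> complex) \<Rightarrow> bool"
  where "schwartz f \<longleftrightarrow> smooth_on UNIV f \<and>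
    (\<forall>N vs. set vs \<subseteq> Basis \<longrightarrow>
       bounded (range (\<lambda>x. (1 + norm x) ^ N *\<^sub>R foldr dir_deriv vs f x)))"

definition fourier :: "('a::euclidean_space \<Rightarrow> complex) \<Rightarrow> 'a \<Rightarrow> complex"
  where "fourier f \<xi> = (\<integral>x. exp (- \<i> * complex_of_real (x \<bullet> \<xi>)) * f x \<partial>lborel)"

text \<open>Only applied to functions whose norms are finite.\<close>

definition lp_norm :: "ennreal \<Rightarrow> ('a::euclidean_space \<Rightarrow> 'b::real_normed_vector) \<Rightarrow> real"
  where "lp_norm p f =
    (if p = \<infinity> then real_of_ereal (esssup lborel (\<lambda>x. ereal (norm (f x))))
     else (\<integral>x. norm (f x) powr enn2real p \<partial>lborel) powr (1 / enn2real p))"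

text \<open>Points of three-dimensional space are written \<open>((x1, x2), x3)\<close>.\<close>

definition mixed_norm ::
  "ennreal \<Rightarrow> ennreal \<Rightarrow> ((real \<times> real) \<times> real \<Rightarrow> complex) \<Rightarrow> real"
  where "mixed_norm p1 p3 f = lp_norm p3 (\<lambda>x3. lp_norm p1 (\<lambda>x. f (x, x3)))"

definition holder_conj :: "ennreal \<Rightarrow> ennreal"
  where "holder_conj p = 1 / (1 - 1 / p)"

definition graph_over ::
  "(real \<times> real) set \<Rightarrow> (real \<times> real \<Rightarrow> real) \<Rightarrow> ((real \<times> real) \<times> real) set"
  where "graph_over \<Omega> \<phi> = (\<lambda>x. (x, \<phi> x)) ` \<Omega>"

text \<open>A measure on the graph itself, so that functions integrated against it only have to
  be measurable there.\<close>

definition surface_measure ::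
  "(real \<times> real) set \<Rightarrow> (real \<times> real \<Rightarrow> real) \<Rightarrow> ((real \<times> real) \<times> real) measure"
  where "surface_measure \<Omega> \<phi> =
    distr
      (density (restrict_space lborel \<Omega>)
        (\<lambda>x. ennreal (sqrt (1 + (partial_deriv (1, 0) \<phi> x)\<^sup>2 + (partial_deriv (0, 1) \<phi> x)\<^sup>2))))
      (restrict_space borel (graph_over \<Omega> \<phi>)) (\<lambda>x. (x, \<phi> x))"

text \<open>A function on the graph is smooth iff it is smooth in the global chart given by the
  projection to \<open>\<Omega>\<close>. The values of \<open>\<rho>\<close> off the graph play no role.\<close>

definition is_amplitude ::
  "(real \<times> real) set \<Rightarrow> (real \<times> real \<Rightarrow> real) \<Rightarrow> ((real \<times> real) \<times> real \<Rightarrow> real) \<Rightarrow> bool"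
  where "is_amplitude \<Omega> \<phi> \<rho> \<longleftrightarrow>
    smooth_on \<Omega> (\<lambda>x. \<rho> (x, \<phi> x)) \<and>
    (\<forall>s\<in>graph_over \<Omega> \<phi>. 0 \<le> \<rho> s) \<and>
    (\<exists>A. compact A \<and> A \<subseteq> graph_over \<Omega> \<phi> \<and> (\<forall>s\<in>graph_over \<Omega> \<phi> - A. \<rho> s = 0))"

end

theory Submission
  imports Defs "HOL-Probability.Probability"
begin

text \<open>
  The proof tests the restriction estimate on Knapp examples. Let
  \<open>g(y\<^sub>1, y\<^sub>2) = \<phi>(y\<^sub>1, y\<^sub>2 + \<psi>(y\<^sub>1))\<close> with \<open>\<psi>(0) = 0\<close>, and let \<open>u, k > 0\<close> be such that
  \<open>u\<alpha>\<^sub>1 + k\<alpha>\<^sub>2 \<ge> 1\<close> for all \<open>\<alpha>\<close> with \<open>\<partial>\<^sup>\<alpha>g(0) \<noteq> 0\<close>. By Taylor's formula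
  \<open>g = O(\<epsilon>)\<close> on the box \<open>\<bar>y\<^sub>1\<bar> \<le> \<epsilon>\<^sup>u\<close>, \<open>\<bar>y\<^sub>2\<bar> \<le> \<epsilon>\<^sup>k\<close>. Hence \<open>\<phi> = O(\<epsilon>)\<close> on the curved tube
  \<open>\<bar>x\<^sub>1\<bar> \<le> \<epsilon>\<^sup>u\<close>, \<open>\<bar>x\<^sub>2 - \<psi>(x\<^sub>1)\<bar> \<le> \<epsilon>\<^sup>k\<close>, whose area is \<open>4 \<epsilon>^(u + k)\<close>.
  If \<open>\<psi>(x\<^sub>1) = O(\<epsilon>\<^sup>b)\<close> for \<open>\<bar>x\<^sub>1\<bar> \<le> \<epsilon>\<^sup>u\<close>, where \<open>b \<le> k\<close>, then the part of the surface above the tube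
  lies in a rectangular box whose sides are of the orders \<open>\<epsilon>\<^sup>u\<close>, \<open>\<epsilon>\<^sup>b\<close> and \<open>\<epsilon>\<close>. A Gaussian adapted to
  the dual box has a Fourier transform that is comparable to its maximum there, and its mixed norm
  scales explicitly. Comparing powers of \<open>\<epsilon>\<close> as \<open>\<epsilon> \<rightarrow> 0\<close> gives
  \<open>(u + b) / p\<^sub>1' + 1 / p\<^sub>3' \<le> (u + k) / 2\<close>, which is \<open>knapp_necessary_condition\<close>.

  In the adapted case take \<open>\<psi> = 0\<close>, \<open>(u, k) = \<kappa>\<close> and \<open>b = k\<close>. The line of weight \<open>\<kappa>\<close> contains an edge of
  the Newton polyhedron, so it supports the polyhedron, and it passes through \<open>(d, d)\<close>, so that
  \<open>\<kappa>\<^sub>1 + \<kappa>\<^sub>2 = 1 / d\<close> (\<open>principal_weight\<close>). The inequality above is then the claim.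

  In the non-adapted case let \<open>\<psi>\<close> be the root jet, of order \<open>m\<close> at \<open>0\<close>, and let \<open>(u, k)\<close> be any weight
  whose line supports the augmented polyhedron. That polyhedron contains \<open>\<N>(g)\<close>, so the box estimate
  applies; it also contains the ray \<open>L\<^sup>+\<close> of slope \<open>-1 / m\<close>, which forces \<open>k \<ge> mu\<close>
  (\<open>augmented_weight_slope\<close>), so \<open>b = mu\<close> is admissible. The inequality becomes
  \<open>2 / p\<^sub>3' \<le> k - wu\<close> with \<open>w = (2 + 2m) / p\<^sub>1' - 1\<close>, and minimizing the right-hand side over \<open>u\<close> produces the
  Legendre transform.

  Two degenerations need care. Weights with a vanishing component are reached as limits of
  positive ones, because a smooth function may contain terms that its Taylor series does not see. And
  \<open>\<N>(g)\<close> must not be empty (\<open>root_coordinates_finite_type\<close>), since otherwise a line with the whole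
  augmented polyhedron on the side of the origin would also count as supporting.
\<close>


section \<open>Calculus of smooth functions\<close>

lemma dir_deriv_eq:
  assumes "(f has_derivative f') (at x)"
  shows "dir_deriv v f x = f' v"
  using frechet_derivative_at[OF assms] by (simp add: dir_deriv_def)

lemma has_derivative_dir_deriv:
  assumes "f differentiable (at x)"
  shows "(f has_derivative (\<lambda>v. dir_deriv v f x)) (at x)"
  using assms unfolding dir_deriv_def frechet_derivative_works .

lemma linear_dir_deriv:
  assumes "f differentiable (at x)"
  shows "linear (\<lambda>v. dir_deriv v f x)"
  using has_derivative_dir_deriv[OF assms] by (rule has_derivative_linear)

lemma differentiable_transform_open:
  assumes "open S" "x \<in> S" "\<And>y. y \<in> S \<Longrightarrow> f y = g y" "f differentiable (at x)"
  shows "g differentiable (at x)" and "dir_deriv v g x = dir_deriv v f x"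
proof -
  have "(g has_derivative (\<lambda>v. dir_deriv v f x)) (at x)"
    using has_derivative_transform_within_open[OF has_derivative_dir_deriv[OF assms(4)] assms(1,2)]
      assms(3) by blast
  then show "g differentiable (at x)" "dir_deriv v g x = dir_deriv v f x"
    by (auto intro: differentiableI dir_deriv_eq)
qed

lemma ck_on_cong:
  assumes "open S" "\<And>x. x \<in> S \<Longrightarrow> f x = g x" "ck_on k S f"
  shows "ck_on k S g"
  using assms(2,3)
proof (induction k arbitrary: f g)
  case 0
  then show ?case by (simp cong: continuous_on_cong)
next
  case (Suc k)
  have d: "f differentiable (at x)" if "x \<in> S" for x
    using Suc.prems(2) that by simp
  have "ck_on k S (dir_deriv v g)" for v
    using Suc.IH[of "dir_deriv v f" "dir_deriv v g"] Suc.prems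
      differentiable_transform_open(2)[OF assms(1) _ Suc.prems(1) d]
    by fastforce
  then show ?case
    using differentiable_transform_open(1)[OF assms(1) _ Suc.prems(1) d] by fastforce
qed

lemma ck_on_Suc_imp: "ck_on (Suc k) S f \<Longrightarrow> ck_on k S f"
proof (induction k arbitrary: f)
  case 0
  then show ?case
    by (auto intro!: continuous_at_imp_continuous_on differentiable_imp_continuous_within)
next
  case (Suc k)
  then show ?case by simp
qed

lemma ck_on_subset: "ck_on k S f \<Longrightarrow> T \<subseteq> S \<Longrightarrow> ck_on k T f"
  by (induction k arbitrary: f) (auto intro: continuous_on_subset)

lemma ck_on_add:
  assumes "open S"
  shows "ck_on k S f \<Longrightarrow> ck_on k S g \<Longrightarrow> ck_on k S (\<lambda>x. f x + g x)"
proof (induction k arbitrary: f g)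
  case 0
  then show ?case by (simp add: continuous_on_add)
next
  case (Suc k)
  have "ck_on k S (dir_deriv v (\<lambda>x. f x + g x))" for v
  proof (rule ck_on_cong[OF assms])
    show "ck_on k S (\<lambda>x. dir_deriv v f x + dir_deriv v g x)"
      using Suc by simp
    show "dir_deriv v f x + dir_deriv v g x = dir_deriv v (\<lambda>x. f x + g x) x" if "x \<in> S" for x
      using dir_deriv_eq[OF has_derivative_add[OF has_derivative_dir_deriv has_derivative_dir_deriv]]
        Suc.prems that by fastforce
  qed
  then show ?case using Suc.prems by simp
qed

lemma ck_on_mult:
  fixes f g :: "'a::euclidean_space \<Rightarrow> real"
  assumes "open S"
  shows "ck_on k S f \<Longrightarrow> ck_on k S g \<Longrightarrow> ck_on k S (\<lambda>x. f x * g x)"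
proof (induction k arbitrary: f g)
  case 0
  then show ?case by (simp add: continuous_on_mult)
next
  case (Suc k)
  have "ck_on k S (dir_deriv v (\<lambda>x. f x * g x))" for v
  proof (rule ck_on_cong[OF assms])
    show "ck_on k S (\<lambda>x. f x * dir_deriv v g x + dir_deriv v f x * g x)"
      using Suc ck_on_Suc_imp[OF Suc.prems(1)] ck_on_Suc_imp[OF Suc.prems(2)]
      by (auto intro!: ck_on_add assms)
    show "f x * dir_deriv v g x + dir_deriv v f x * g x = dir_deriv v (\<lambda>x. f x * g x) x"
      if "x \<in> S" for x
      using dir_deriv_eq[OF has_derivative_mult[OF has_derivative_dir_deriv has_derivative_dir_deriv]]
        Suc.prems that by fastforce
  qed
  then show ?case using Suc.prems by (simp add: differentiable_mult)
qed

lemma ck_on_compose_fst: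
  fixes \<psi> :: "real \<Rightarrow> real"
  shows "ck_on k U \<psi> \<Longrightarrow> open U \<Longrightarrow> ck_on k (fst -` U) (\<lambda>y::real \<times> real. \<psi> (fst y))"
proof (induction k arbitrary: \<psi>)
  case 0
  then show ?case
    by (auto intro!: continuous_on_compose2[of U \<psi>] continuous_on_fst continuous_on_id)
next
  case (Suc k)
  have op: "open (fst -` U :: (real \<times> real) set)"
    using Suc.prems(2) by (rule open_vimage_fst)
  have D: "((\<lambda>y::real \<times> real. \<psi> (fst y)) has_derivative (\<lambda>v. dir_deriv (fst v) \<psi> (fst y))) (at y)"
    if "y \<in> fst -` U" for y :: "real \<times> real"
    using has_derivative_compose[of fst fst y UNIV \<psi> "\<lambda>v. dir_deriv v \<psi> (fst y)"]
      has_derivative_fst[OF has_derivative_ident] has_derivative_dir_deriv[of \<psi> "fst y"] Suc.prems that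
    by auto
  have "ck_on k (fst -` U) (dir_deriv v (\<lambda>y. \<psi> (fst y)))" for v :: "real \<times> real"
  proof (rule ck_on_cong[OF op])
    show "ck_on k (fst -` U) (\<lambda>y::real \<times> real. dir_deriv (fst v) \<psi> (fst y))"
      using Suc.prems Suc.IH[of "dir_deriv (fst v) \<psi>"] by simp
  qed (rule dir_deriv_eq[OF D, symmetric])
  moreover have "\<forall>y\<in>fst -` U. (\<lambda>y::real \<times> real. \<psi> (fst y)) differentiable (at y)"
    using D differentiableI by blast
  ultimately show ?case by (simp only: ck_on.simps) blast
qed

lemma smooth_on_ck: "smooth_on S f \<Longrightarrow> ck_on k S f"
  by (simp add: smooth_on_def)

lemma smooth_on_continuous_on: "smooth_on S f \<Longrightarrow> continuous_on S f"
  using smooth_on_ck[of S f 0] by simp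

lemma smooth_on_differentiable: "smooth_on S f \<Longrightarrow> x \<in> S \<Longrightarrow> f differentiable (at x)"
  using smooth_on_ck[of S f "Suc 0"] by simp

lemma smooth_on_dir_deriv: "smooth_on S f \<Longrightarrow> smooth_on S (dir_deriv v f)"
  unfolding smooth_on_def using ck_on.simps(2) by blast

text \<open>The map \<open>y \<mapsto> (y\<^sub>1, y\<^sub>2 + \<psi>(y\<^sub>1))\<close> is a shear, so by the chain rule a derivative of the composition
  in direction \<open>v\<close> is the derivative of \<open>f\<close> in direction \<open>v\<close> plus \<open>v\<^sub>1 \<psi>'(y\<^sub>1)\<close> times the one in direction
  \<open>(0, 1)\<close>, both composed with the shear. The statement therefore reproduces itself for the
  derivatives of \<open>f\<close>, with one order of differentiability less to prove.\<close>

lemma smooth_on_root_coordinates: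
  fixes f :: "real \<times> real \<Rightarrow> real"
  assumes S: "open S" and T: "open T" and U: "open U" and psi: "smooth_on U \<psi>"
    and f: "smooth_on S f"
    and TU: "\<And>y. y \<in> T \<Longrightarrow> fst y \<in> U \<and> (fst y, snd y + \<psi> (fst y)) \<in> S"
  shows "smooth_on T (root_coordinates f \<psi>)"
proof -
  have eq: "root_coordinates f \<psi> = (\<lambda>y. f (fst y, snd y + \<psi> (fst y)))" for f
    by (auto simp: root_coordinates_def)
  have "ck_on k T (root_coordinates f \<psi>)" for k
    using f
  proof (induction k arbitrary: f)
    case 0
    have "continuous_on T (\<lambda>y. (fst y, snd y + \<psi> (fst y)))"
      using TU by (intro continuous_intros
          continuous_on_compose2[OF smooth_on_continuous_on[OF psi]]) auto
    then show ?case
      unfolding eq using TU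
      by (auto intro!: continuous_on_compose2[OF smooth_on_continuous_on[OF 0]])
  next
    case (Suc k)
    have D: "(root_coordinates f \<psi> has_derivative
        (\<lambda>v. root_coordinates (dir_deriv v f) \<psi> y +
          dir_deriv (fst v) \<psi> (fst y) * root_coordinates (dir_deriv (0, 1) f) \<psi> y)) (at y)"
      if y: "y \<in> T" for y
    proof -
      let ?p = "(fst y, snd y + \<psi> (fst y))"
      have df: "f differentiable (at ?p)"
        using smooth_on_differentiable[OF Suc.prems] TU[OF y] by blast
      have dp: "\<psi> differentiable (at (fst y))"
        using smooth_on_differentiable[OF psi] TU[OF y] by blast
      have "((\<lambda>y. \<psi> (fst y)) has_derivative (\<lambda>v. dir_deriv (fst v) \<psi> (fst y))) (at y)"
        using has_derivative_compose[of fst fst y UNIV \<psi> "\<lambda>v. dir_deriv v \<psi> (fst y)"]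
          has_derivative_fst[OF has_derivative_ident] has_derivative_dir_deriv[OF dp]
        by auto
      then have "((\<lambda>y. (fst y, snd y + \<psi> (fst y))) has_derivative
          (\<lambda>v. (fst v, snd v + dir_deriv (fst v) \<psi> (fst y)))) (at y)"
        by (intro derivative_intros)
      then have "((\<lambda>y. f (fst y, snd y + \<psi> (fst y))) has_derivative
          (\<lambda>v. dir_deriv (fst v, snd v + dir_deriv (fst v) \<psi> (fst y)) f ?p)) (at y)"
        using has_derivative_compose has_derivative_dir_deriv[OF df] by fast
      moreover have "dir_deriv (fst v, snd v + c) f ?p = dir_deriv v f ?p + c * dir_deriv (0, 1) f ?p"
        for v c
        using linear_add[OF linear_dir_deriv[OF df], of v "c *\<^sub>R (0, 1)"]
          linear_cmul[OF linear_dir_deriv[OF df], of c "(0, 1)"] by (cases v) simp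
      ultimately show ?thesis unfolding eq by simp
    qed
    have "ck_on k T (dir_deriv v (root_coordinates f \<psi>))" for v
    proof (rule ck_on_cong[OF T])
      have "ck_on k T (\<lambda>y. dir_deriv (fst v) \<psi> (fst y))"
        using ck_on_subset[OF ck_on_compose_fst[OF smooth_on_ck[OF smooth_on_dir_deriv[OF psi]] U]] TU
        by blast
      then show "ck_on k T (\<lambda>y. root_coordinates (dir_deriv v f) \<psi> y +
          dir_deriv (fst v) \<psi> (fst y) * root_coordinates (dir_deriv (0, 1) f) \<psi> y)"
        using Suc.IH[OF smooth_on_dir_deriv[OF Suc.prems]]
        by (intro ck_on_add ck_on_mult T) auto
    qed (use dir_deriv_eq[OF D] in simp)
    then show ?case using differentiableI[OF D] by simp
  qed
  then show ?thesis by (simp add: smooth_on_def)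
qed

section \<open>Size of a function on anisotropic boxes\<close>

lemma mean_value_line:
  fixes h :: "'a::euclidean_space \<Rightarrow> real"
  assumes "\<And>t. \<bar>t\<bar> \<le> \<bar>x\<bar> \<Longrightarrow> h differentiable (at (p + t *\<^sub>R v))"
  obtains s where "\<bar>s\<bar> \<le> \<bar>x\<bar>" "h (p + x *\<^sub>R v) - h p = x * dir_deriv v h (p + s *\<^sub>R v)"
proof -
  have D: "((\<lambda>t. h (p + t *\<^sub>R v)) has_real_derivative dir_deriv v h (p + t *\<^sub>R v)) (at t)"
    if "\<bar>t\<bar> \<le> \<bar>x\<bar>" for t
  proof -
    note d = assms[OF that]
    have "((\<lambda>t. p + t *\<^sub>R v) has_derivative (\<lambda>s. s *\<^sub>R v)) (at t)"
      by (auto intro!: derivative_eq_intros)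
    then have "((\<lambda>t. h (p + t *\<^sub>R v)) has_derivative (\<lambda>s. dir_deriv (s *\<^sub>R v) h (p + t *\<^sub>R v))) (at t)"
      using has_derivative_compose has_derivative_dir_deriv[OF d] by fast
    moreover have "dir_deriv (s *\<^sub>R v) h (p + t *\<^sub>R v) = dir_deriv v h (p + t *\<^sub>R v) * s" for s
      using linear_cmul[OF linear_dir_deriv[OF d], of s v] by simp
    ultimately show ?thesis by (simp add: has_field_derivative_def)
  qed
  consider "x = 0" | "x < 0" | "0 < x" by linarith
  then show ?thesis
  proof cases
    case 1
    then show ?thesis using that[of 0] by simp
  next
    case 2
    obtain s where "x < s" "s < 0"
      "h (p + 0 *\<^sub>R v) - h (p + x *\<^sub>R v) = (0 - x) * dir_deriv v h (p + s *\<^sub>R v)"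
      using MVT2[OF 2, of "\<lambda>t. h (p + t *\<^sub>R v)" "\<lambda>t. dir_deriv v h (p + t *\<^sub>R v)"] D 2 by force
    then show ?thesis using that[of s] by (simp add: algebra_simps)
  next
    case 3
    obtain s where "0 < s" "s < x"
      "h (p + x *\<^sub>R v) - h (p + 0 *\<^sub>R v) = (x - 0) * dir_deriv v h (p + s *\<^sub>R v)"
      using MVT2[OF 3, of "\<lambda>t. h (p + t *\<^sub>R v)" "\<lambda>t. dir_deriv v h (p + t *\<^sub>R v)"] D 3 by force
    then show ?thesis using that[of s] by (simp add: algebra_simps)
  qed
qed

definition scaled_box :: "real \<Rightarrow> real \<Rightarrow> real \<Rightarrow> (real \<times> real) set"
  where "scaled_box u k \<epsilon> = {y. \<bar>fst y\<bar> \<le> \<epsilon> powr u \<and> \<bar>snd y\<bar> \<le> \<epsilon> powr k}"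

lemma eventually_powr_less:
  assumes "0 < (u::real)" "0 < r"
  shows "\<forall>\<^sub>F \<epsilon> in at_right 0. \<epsilon> powr u < r"
proof -
  have "((\<lambda>\<epsilon>::real. \<epsilon> powr u) \<longlongrightarrow> 0) (at_right 0)"
    using assms by (auto intro!: tendsto_eq_intros tendsto_powr2 simp: eventually_at_right_less
        eventually_mono[OF eventually_at_right_less[of 0]])
  then show ?thesis using assms(2) by (rule order_tendstoD)
qed

lemma eventually_at_right_unit: "\<forall>\<^sub>F \<epsilon> in at_right 0. 0 < \<epsilon> \<and> \<epsilon> < (1::real)"
  using eventually_at_right_real[of 0 1] by (auto elim: eventually_mono)

lemma eventually_scaled_box_subset:
  assumes "open S" "0 \<in> S" "0 < u" "0 < k"
  shows "\<forall>\<^sub>F \<epsilon> in at_right 0. scaled_box u k \<epsilon> \<subseteq> S"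
proof -
  obtain r where r: "r > 0" "ball 0 r \<subseteq> S"
    using assms(1,2) openE by blast
  have "\<forall>\<^sub>F \<epsilon> in at_right 0. \<epsilon> powr u < r / 2" "\<forall>\<^sub>F \<epsilon> in at_right 0. \<epsilon> powr k < r / 2"
    using eventually_powr_less[OF assms(3), of "r/2"] eventually_powr_less[OF assms(4), of "r/2"] r
    by auto
  then show ?thesis
  proof eventually_elim
    case (elim \<epsilon>)
    have "y \<in> S" if "y \<in> scaled_box u k \<epsilon>" for y
    proof -
      have "norm y \<le> \<bar>fst y\<bar> + \<bar>snd y\<bar>"
        using norm_Pair_le[of "fst y" "snd y"] by simp
      also have "\<dots> < r" using that elim by (auto simp: scaled_box_def)
      finally show ?thesis using r(2) by (auto simp: mem_ball_0)
    qed
    then show ?case by blast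
  qed
qed

lemma smooth_on_locally_bounded:
  fixes h :: "real \<times> real \<Rightarrow> real"
  assumes "open S" "0 \<in> S" "0 < u" "0 < k" "smooth_on S h" "s \<le> 0"
  shows "\<exists>C\<ge>0. \<forall>\<^sub>F \<epsilon> in at_right 0. \<forall>y\<in>scaled_box u k \<epsilon>. \<bar>h y\<bar> \<le> C * \<epsilon> powr s"
proof -
  let ?T = "{y \<in> S. \<bar>h y\<bar> < \<bar>h 0\<bar> + 1}"
  have "open (S \<inter> (\<lambda>y. \<bar>h y\<bar>) -` {..<\<bar>h 0\<bar> + 1})"
    using smooth_on_continuous_on[OF assms(5)] assms(1)
    by (intro continuous_open_preimage continuous_intros) auto
  also have "S \<inter> (\<lambda>y. \<bar>h y\<bar>) -` {..<\<bar>h 0\<bar> + 1} = ?T" by auto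
  finally have "open ?T" .
  then have "\<forall>\<^sub>F \<epsilon> in at_right 0. scaled_box u k \<epsilon> \<subseteq> ?T"
    using assms by (intro eventually_scaled_box_subset) auto
  then have "\<forall>\<^sub>F \<epsilon> in at_right 0. \<forall>y\<in>scaled_box u k \<epsilon>. \<bar>h y\<bar> \<le> (\<bar>h 0\<bar> + 1) * \<epsilon> powr s"
    using eventually_at_right_unit
  proof eventually_elim
    case (elim \<epsilon>)
    have "1 \<le> \<epsilon> powr s"
      using elim assms(6) powr_mono'[of s 0 \<epsilon>] by simp
    then have "(\<bar>h 0\<bar> + 1) * 1 \<le> (\<bar>h 0\<bar> + 1) * \<epsilon> powr s"
      by (intro mult_left_mono) auto
    then show ?case using elim by fastforce
  qed
  then show ?thesis by (intro exI[of _ "\<bar>h 0\<bar> + 1"]) auto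
qed

text \<open>Induction along the order of the Taylor expansion: if \<open>s > 0\<close>, the hypothesis on the derivatives
  forces \<open>h 0 = 0\<close>, and the mean value theorem trades \<open>s\<close> for \<open>s - u\<close> and \<open>h\<close> for its derivative, until
  \<open>s \<le> 0\<close>, where boundedness near \<open>0\<close> suffices.\<close>

lemma axis_bound:
  fixes h :: "real \<times> real \<Rightarrow> real"
  assumes S: "open S" "0 \<in> S" and u: "0 < u"
  shows "smooth_on S h \<Longrightarrow> s \<le> real N * u \<Longrightarrow>
    (\<And>a. (dir_deriv (1, 0) ^^ a) h 0 \<noteq> 0 \<Longrightarrow> s \<le> u * real a) \<Longrightarrow>
    \<exists>C\<ge>0. \<forall>\<^sub>F \<epsilon> in at_right 0. \<forall>x. \<bar>x\<bar> \<le> \<epsilon> powr u \<longrightarrow> \<bar>h (x, 0)\<bar> \<le> C * \<epsilon> powr s"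
proof (induction N arbitrary: h s)
  case 0
  then show ?case
    using smooth_on_locally_bounded[OF S u zero_less_one, of h s]
    by (auto simp: scaled_box_def elim!: eventually_mono)
next
  case (Suc N)
  let ?D = "dir_deriv (1, 0) :: (real \<times> real \<Rightarrow> real) \<Rightarrow> real \<times> real \<Rightarrow> real"
  show ?case
  proof (cases "s \<le> 0")
    case True
    then show ?thesis
      using smooth_on_locally_bounded[OF S u zero_less_one Suc.prems(1), of s]
      by (auto simp: scaled_box_def elim!: eventually_mono)
  next
    case False
    then have h0: "h 0 = 0"
      using Suc.prems(3)[of 0] by auto
    have "\<exists>C\<ge>0. \<forall>\<^sub>F \<epsilon> in at_right 0. \<forall>x. \<bar>x\<bar> \<le> \<epsilon> powr u \<longrightarrow> \<bar>?D h (x, 0)\<bar> \<le> C * \<epsilon> powr (s - u)"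
    proof (rule Suc.IH[OF smooth_on_dir_deriv[OF Suc.prems(1)]])
      show "s - u \<le> real N * u"
        using Suc.prems(2) by (simp add: algebra_simps)
      show "s - u \<le> u * real a" if "(?D ^^ a) (?D h) 0 \<noteq> 0" for a
        using Suc.prems(3)[of "Suc a"] that
        by (simp add: funpow_Suc_right algebra_simps del: funpow.simps)
    qed
    then obtain C where C: "C \<ge> 0" and
      ev: "\<forall>\<^sub>F \<epsilon> in at_right 0. \<forall>x. \<bar>x\<bar> \<le> \<epsilon> powr u \<longrightarrow> \<bar>?D h (x, 0)\<bar> \<le> C * \<epsilon> powr (s - u)"
      by blast
    from ev eventually_scaled_box_subset[OF S u zero_less_one]
    have "\<forall>\<^sub>F \<epsilon> in at_right 0. \<forall>x. \<bar>x\<bar> \<le> \<epsilon> powr u \<longrightarrow> \<bar>h (x, 0)\<bar> \<le> C * \<epsilon> powr s"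
    proof eventually_elim
      case (elim \<epsilon>)
      show ?case
      proof (intro allI impI)
        fix x assume x: "\<bar>x\<bar> \<le> \<epsilon> powr u"
        have "h differentiable (at (0 + t *\<^sub>R (1, 0)))" if "\<bar>t\<bar> \<le> \<bar>x\<bar>" for t
          using elim(2) x that by (intro smooth_on_differentiable[OF Suc.prems(1)]) (auto simp: scaled_box_def)
        then obtain t where t: "\<bar>t\<bar> \<le> \<bar>x\<bar>"
          "h (0 + x *\<^sub>R (1, 0)) - h 0 = x * ?D h (0 + t *\<^sub>R (1, 0))"
          by (rule mean_value_line)
        then have "\<bar>h (x, 0)\<bar> = \<bar>x\<bar> * \<bar>?D h (t, 0)\<bar>"
          by (simp add: h0 abs_mult)
        also have "\<dots> \<le> \<epsilon> powr u * (C * \<epsilon> powr (s - u))"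
          using elim(1) t(1) x by (intro mult_mono) auto
        also have "\<dots> = C * \<epsilon> powr s"
          by (simp flip: powr_add)
        finally show "\<bar>h (x, 0)\<bar> \<le> C * \<epsilon> powr s" .
      qed
    qed
    then show ?thesis using C by blast
  qed
qed

text \<open>The value of \<open>h\<close> on the first axis is controlled by \<open>axis_bound\<close>, and the mean value theorem
  in the second variable trades \<open>s\<close> for \<open>s - k\<close>. Expanding in the second variable first matches the
  order in which \<^const>\<open>partial_deriv\<close> differentiates, so mixed derivatives never have to be
  interchanged.\<close>

lemma scaled_box_bound_aux:
  fixes h :: "real \<times> real \<Rightarrow> real"
  assumes S: "open S" "0 \<in> S" and uk: "0 < u" "0 < k"
  shows "smooth_on S h \<Longrightarrow> s \<le> real N * k \<Longrightarrow>
    (\<And>\<alpha>. partial_deriv \<alpha> h 0 \<noteq> 0 \<Longrightarrow> s \<le> u * real (fst \<alpha>) + k * real (snd \<alpha>)) \<Longrightarrow>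
    \<exists>C\<ge>0. \<forall>\<^sub>F \<epsilon> in at_right 0. \<forall>y\<in>scaled_box u k \<epsilon>. \<bar>h y\<bar> \<le> C * \<epsilon> powr s"
proof (induction N arbitrary: h s)
  case 0
  then show ?case
    using smooth_on_locally_bounded[OF S uk, of h s] by auto
next
  case (Suc N)
  let ?D = "dir_deriv (0, 1) :: (real \<times> real \<Rightarrow> real) \<Rightarrow> real \<times> real \<Rightarrow> real"
  obtain M :: nat where M: "s / u \<le> real M"
    using real_arch_simple by blast
  have "\<exists>C\<ge>0. \<forall>\<^sub>F \<epsilon> in at_right 0. \<forall>x. \<bar>x\<bar> \<le> \<epsilon> powr u \<longrightarrow> \<bar>h (x, 0)\<bar> \<le> C * \<epsilon> powr s"
  proof (rule axis_bound[OF S uk(1) Suc.prems(1)])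
    show "s \<le> real M * u"
      using M uk by (simp add: divide_le_eq)
    show "s \<le> u * real a" if "(dir_deriv (1, 0) ^^ a) h 0 \<noteq> 0" for a
      using Suc.prems(3)[of "(a, 0)"] that by (simp add: partial_deriv_def)
  qed
  then obtain C1 where C1: "C1 \<ge> 0" and
    ev1: "\<forall>\<^sub>F \<epsilon> in at_right 0. \<forall>x. \<bar>x\<bar> \<le> \<epsilon> powr u \<longrightarrow> \<bar>h (x, 0)\<bar> \<le> C1 * \<epsilon> powr s"
    by blast
  have "\<exists>C\<ge>0. \<forall>\<^sub>F \<epsilon> in at_right 0. \<forall>y\<in>scaled_box u k \<epsilon>. \<bar>?D h y\<bar> \<le> C * \<epsilon> powr (s - k)"
  proof (rule Suc.IH[OF smooth_on_dir_deriv[OF Suc.prems(1)]])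
    show "s - k \<le> real N * k"
      using Suc.prems(2) by (simp add: algebra_simps)
    show "s - k \<le> u * real (fst \<alpha>) + k * real (snd \<alpha>)" if "partial_deriv \<alpha> (?D h) 0 \<noteq> 0" for \<alpha>
      using Suc.prems(3)[of "(fst \<alpha>, Suc (snd \<alpha>))"] that
      by (simp add: partial_deriv_def funpow_Suc_right algebra_simps del: funpow.simps)
  qed
  then obtain C2 where C2: "C2 \<ge> 0" and
    ev2: "\<forall>\<^sub>F \<epsilon> in at_right 0. \<forall>y\<in>scaled_box u k \<epsilon>. \<bar>?D h y\<bar> \<le> C2 * \<epsilon> powr (s - k)"
    by blast
  from ev1 ev2 eventually_scaled_box_subset[OF S uk]
  have "\<forall>\<^sub>F \<epsilon> in at_right 0. \<forall>y\<in>scaled_box u k \<epsilon>. \<bar>h y\<bar> \<le> (C1 + C2) * \<epsilon> powr s"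
  proof eventually_elim
    case (elim \<epsilon>)
    show ?case
    proof
      fix y assume y: "y \<in> scaled_box u k \<epsilon>"
      let ?p = "(fst y, 0)"
      have in_box: "?p + t *\<^sub>R (0, 1) \<in> scaled_box u k \<epsilon>" if "\<bar>t\<bar> \<le> \<bar>snd y\<bar>" for t
        using y that by (auto simp: scaled_box_def)
      then have "h differentiable (at (?p + t *\<^sub>R (0, 1)))" if "\<bar>t\<bar> \<le> \<bar>snd y\<bar>" for t
        using elim(3) that by (intro smooth_on_differentiable[OF Suc.prems(1)]) auto
      then obtain t where t: "\<bar>t\<bar> \<le> \<bar>snd y\<bar>"
        "h (?p + snd y *\<^sub>R (0, 1)) - h ?p = snd y * ?D h (?p + t *\<^sub>R (0, 1))"
        by (rule mean_value_line)
      then have "\<bar>h y - h ?p\<bar> = \<bar>snd y\<bar> * \<bar>?D h (?p + t *\<^sub>R (0, 1))\<bar>"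
        by (simp add: abs_mult)
      also have "\<dots> \<le> \<epsilon> powr k * (C2 * \<epsilon> powr (s - k))"
        using bspec[OF elim(2) in_box[OF t(1)]] y by (intro mult_mono) (auto simp: scaled_box_def)
      also have "\<dots> = C2 * \<epsilon> powr s"
        by (simp flip: powr_add)
      finally have "\<bar>h y - h ?p\<bar> \<le> C2 * \<epsilon> powr s" .
      moreover have "\<bar>h ?p\<bar> \<le> C1 * \<epsilon> powr s"
        using elim(1) y by (auto simp: scaled_box_def)
      ultimately show "\<bar>h y\<bar> \<le> (C1 + C2) * \<epsilon> powr s"
        by (simp add: algebra_simps)
    qed
  qed
  then show ?case using C1 C2 by (intro exI[of _ "C1 + C2"]) auto
qed

text \<open>The weighted Taylor estimate: a smooth function is \<open>O(\<epsilon>\<^sup>s)\<close> on the box with sides \<open>\<epsilon>\<^sup>u\<close> and \<open>\<epsilon>\<^sup>k\<close> as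
  soon as every monomial of its Taylor series is.\<close>

lemma scaled_box_bound:
  fixes h :: "real \<times> real \<Rightarrow> real"
  assumes "open S" "0 \<in> S" "0 < u" "0 < k" "smooth_on S h"
    and "\<And>\<alpha>. partial_deriv \<alpha> h 0 \<noteq> 0 \<Longrightarrow> s \<le> u * real (fst \<alpha>) + k * real (snd \<alpha>)"
  obtains C where "0 \<le> C" "\<forall>\<^sub>F \<epsilon> in at_right 0. \<forall>y\<in>scaled_box u k \<epsilon>. \<bar>h y\<bar> \<le> C * \<epsilon> powr s"
proof -
  obtain N :: nat where "s / k \<le> real N"
    using real_arch_simple by blast
  then have "s \<le> real N * k"
    using assms(4) by (simp add: divide_le_eq)
  then show ?thesis
    using scaled_box_bound_aux[OF assms(1-5)] assms(6) that by blast
qed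

definition flat_at_0 :: "('a::euclidean_space \<Rightarrow> real) \<Rightarrow> bool"
  where "flat_at_0 f \<longleftrightarrow> (\<forall>n. \<exists>C. \<forall>\<^sub>F x in nhds 0. \<bar>f x\<bar> \<le> C * norm x ^ n)"

lemma flat_at_0_imp_zero: "flat_at_0 f \<Longrightarrow> f 0 = 0"
  unfolding flat_at_0_def using eventually_nhds_x_imp_x
  by (metis abs_le_zero_iff mult_zero_right norm_zero power_0_Suc power_one_right)

text \<open>With the step \<open>t = \<bar>x\<bar>\<^sup>N\<close>, the difference quotient of \<open>f\<close> in direction \<open>v\<close> is \<open>O(t\<^sup>2) / t = O(t)\<close>,
  because \<open>f = O(\<bar>x\<bar>^(2N))\<close>. It differs from the derivative at \<open>x\<close> by
  \<open>O(t)\<close>, because the second derivative is bounded near \<open>0\<close>.\<close>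

lemma flat_at_0_dir_deriv:
  fixes f :: "'a::euclidean_space \<Rightarrow> real"
  assumes S: "open S" "0 \<in> S" and f: "smooth_on S f" and "flat_at_0 f"
  shows "flat_at_0 (dir_deriv v f)"
proof -
  let ?g = "dir_deriv v f"
  have g: "smooth_on S ?g" and w: "smooth_on S (dir_deriv v ?g)"
    using f by (auto intro: smooth_on_dir_deriv)
  let ?M = "\<bar>dir_deriv v ?g 0\<bar> + 1"
  have "open (S \<inter> (\<lambda>y. \<bar>dir_deriv v ?g y\<bar>) -` {..<?M})"
    using smooth_on_continuous_on[OF w] S(1)
    by (intro continuous_open_preimage continuous_intros) auto
  moreover have "0 \<in> S \<inter> (\<lambda>y. \<bar>dir_deriv v ?g y\<bar>) -` {..<?M}"
    using S(2) by auto
  ultimately obtain r where r: "r > 0" "ball 0 r \<subseteq> S \<inter> (\<lambda>y. \<bar>dir_deriv v ?g y\<bar>) -` {..<?M}"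
    using openE by blast
  have "\<exists>C. \<forall>\<^sub>F x in nhds 0. \<bar>?g x\<bar> \<le> C * norm x ^ n" for n
  proof -
    \<comment> \<open>The exponent is raised by one so that the step \<open>t\<close> is at most \<open>\<bar>x\<bar>\<close> and the bound tends to \<open>0\<close>
      also for \<open>n = 0\<close>; the latter gives the estimate at \<open>x = 0\<close>, where the step would vanish.\<close>
    define N where "N = Suc n"
    define L where "L = 1 + norm v"
    have L: "L \<ge> 1" by (simp add: L_def)
    obtain C0 where "\<forall>\<^sub>F x in nhds 0. \<bar>f x\<bar> \<le> C0 * norm x ^ (2 * N)"
      using \<open>flat_at_0 f\<close> unfolding flat_at_0_def by blast
    then obtain d0 where d0: "d0 > 0" "\<And>x. norm x < d0 \<Longrightarrow> \<bar>f x\<bar> \<le> C0 * norm x ^ (2 * N)"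
      by (auto simp: eventually_nhds_metric)
    define C where "C = \<bar>C0\<bar> * L ^ (2 * N)"
    have C: "C \<ge> 0" using L by (simp add: C_def)
    define e where "e = min 1 (min (r / L) (d0 / L))"
    have e: "e > 0" "e \<le> 1" "e * L \<le> r" "e * L \<le> d0"
      using r d0 L by (auto simp: e_def min_def field_simps)
    have main: "\<bar>?g x\<bar> \<le> (2 * C + ?M) * norm x ^ N" if x: "x \<noteq> 0" "norm x < e" for x
    proof -
      define t where "t = norm x ^ N"
      have t: "0 < t" "t \<le> norm x"
        using x e power_decreasing[of 1 N "norm x"] by (auto simp: t_def N_def)
      have small: "norm (x + s *\<^sub>R v) \<le> L * norm x" if "\<bar>s\<bar> \<le> t" for s
      proof -
        have "norm (x + s *\<^sub>R v) \<le> norm x + \<bar>s\<bar> * norm v"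
          using norm_triangle_ineq[of x "s *\<^sub>R v"] by simp
        also have "\<dots> \<le> norm x + norm x * norm v"
          using that t by (intro add_mono mult_right_mono) auto
        finally show ?thesis by (simp add: L_def algebra_simps)
      qed
      have "L * norm x < L * e"
        using x(2) L by (intro mult_strict_left_mono) auto
      then have Lx: "L * norm x < r" "L * norm x < d0"
        using e(3,4) by (simp_all only: mult.commute[of L e])
      have fb: "\<bar>f (x + s *\<^sub>R v)\<bar> \<le> C * t\<^sup>2" if "\<bar>s\<bar> \<le> t" for s
      proof -
        have "\<bar>f (x + s *\<^sub>R v)\<bar> \<le> C0 * norm (x + s *\<^sub>R v) ^ (2 * N)"
          using small[OF that] Lx by (intro d0(2)) auto
        also have "\<dots> \<le> \<bar>C0\<bar> * (L * norm x) ^ (2 * N)"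
          using small[OF that] by (intro mult_mono power_mono) auto
        finally show ?thesis
          by (simp add: C_def t_def power_mult_distrib power_mult[symmetric] mult.commute mult.left_commute)
      qed
      have inS: "x + s *\<^sub>R v \<in> S" "\<bar>dir_deriv v ?g (x + s *\<^sub>R v)\<bar> \<le> ?M" if "\<bar>s\<bar> \<le> t" for s
      proof -
        have "x + s *\<^sub>R v \<in> ball 0 r"
          using small[OF that] Lx by simp
        then show "x + s *\<^sub>R v \<in> S" "\<bar>dir_deriv v ?g (x + s *\<^sub>R v)\<bar> \<le> ?M" using r(2) by auto
      qed
      have "f differentiable (at (x + s *\<^sub>R v))" if "\<bar>s\<bar> \<le> \<bar>t\<bar>" for s
        using inS(1)[of s] t that by (intro smooth_on_differentiable[OF f]) auto
      then obtain s where s: "\<bar>s\<bar> \<le> \<bar>t\<bar>" "f (x + t *\<^sub>R v) - f x = t * ?g (x + s *\<^sub>R v)"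
        by (rule mean_value_line)
      have "?g differentiable (at (x + q *\<^sub>R v))" if "\<bar>q\<bar> \<le> \<bar>s\<bar>" for q
        using inS(1)[of q] t that s by (intro smooth_on_differentiable[OF g]) auto
      then obtain q where q: "\<bar>q\<bar> \<le> \<bar>s\<bar>"
        "?g (x + s *\<^sub>R v) - ?g x = s * dir_deriv v ?g (x + q *\<^sub>R v)"
        by (rule mean_value_line)
      have "t * \<bar>?g (x + s *\<^sub>R v)\<bar> = \<bar>f (x + t *\<^sub>R v) - f x\<bar>"
        using s(2) t by (simp add: abs_mult)
      also have "\<dots> \<le> t * (2 * C * t)"
        using abs_triangle_ineq4[of "f (x + t *\<^sub>R v)" "f x"] fb[of t] fb[of 0] t
        by (simp add: power2_eq_square algebra_simps)
      finally have "\<bar>?g (x + s *\<^sub>R v)\<bar> \<le> 2 * C * t"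
        using t by simp
      moreover have "\<bar>?g (x + s *\<^sub>R v) - ?g x\<bar> \<le> t * ?M"
        unfolding q(2) abs_mult using inS(2)[of q] q(1) s(1) t by (intro mult_mono) auto
      ultimately show ?thesis
        by (simp add: t_def algebra_simps)
    qed
    have "isCont ?g 0"
      using smooth_on_continuous_on[OF g] S by (simp add: continuous_on_eq_continuous_at)
    then have lim: "((\<lambda>x. \<bar>?g x\<bar>) \<longlongrightarrow> \<bar>?g 0\<bar>) (at 0)"
      by (intro tendsto_intros) (simp add: isCont_def)
    have "((\<lambda>x::'a. (2 * C + ?M) * norm x ^ N) \<longlongrightarrow> (2 * C + ?M) * norm (0::'a) ^ N) (at 0)"
      by (intro tendsto_intros)
    moreover have "\<forall>\<^sub>F x in at 0. \<bar>?g x\<bar> \<le> (2 * C + ?M) * norm x ^ N"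
      using main e(1) by (auto simp: eventually_at intro!: exI[of _ e])
    ultimately have "\<bar>?g 0\<bar> \<le> (2 * C + ?M) * norm (0::'a) ^ N"
      using lim by (intro tendsto_le[of "at (0::'a)"]) auto
    then have g0: "?g 0 = 0" by (simp add: N_def)
    have "\<bar>?g x\<bar> \<le> (2 * C + ?M) * norm x ^ n" if x: "norm x < e" for x
    proof (cases "x = 0")
      case True
      then show ?thesis using g0 C by simp
    next
      case False
      have "norm x ^ N \<le> norm x ^ n"
        using x e by (intro power_decreasing) (auto simp: N_def)
      then have "(2 * C + ?M) * norm x ^ N \<le> (2 * C + ?M) * norm x ^ n"
        using C by (intro mult_left_mono) auto
      then show ?thesis using main[OF False x] by linarith
    qed
    then have "\<forall>\<^sub>F x in nhds 0. \<bar>?g x\<bar> \<le> (2 * C + ?M) * norm x ^ n"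
      using e(1) unfolding eventually_nhds_metric by (intro exI[of _ e]) auto
    then show ?thesis by blast
  qed
  then show ?thesis by (simp add: flat_at_0_def)
qed

lemma flat_at_0_imp_partial_deriv_zero:
  assumes S: "open S" "0 \<in> S" and f: "smooth_on S f" and "flat_at_0 f"
  shows "partial_deriv \<alpha> f 0 = 0"
proof -
  have iter: "smooth_on S ((dir_deriv v ^^ n) f) \<and> flat_at_0 ((dir_deriv v ^^ n) f)"
    if "smooth_on S f" "flat_at_0 f" for f :: "real \<times> real \<Rightarrow> real" and v n
    using that
    by (induction n) (auto intro: smooth_on_dir_deriv flat_at_0_dir_deriv[OF S])
  show ?thesis
    unfolding partial_deriv_def
    using iter[OF f \<open>flat_at_0 f\<close>, THEN conjunct1, THEN iter, OF iter[OF f \<open>flat_at_0 f\<close>, THEN conjunct2]]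
    by (intro flat_at_0_imp_zero) blast
qed

section \<open>Geometry of Newton polyhedra\<close>

lemma newton_polyhedron_translate:
  assumes "t \<in> newton_polyhedron f" "0 \<le> fst v" "0 \<le> snd v"
  shows "v + t \<in> newton_polyhedron f"
proof -
  let ?X = "\<Union>\<alpha>\<in>{\<alpha>. partial_deriv \<alpha> f 0 \<noteq> 0}. {(t1, t2). t1 \<ge> real (fst \<alpha>) \<and> t2 \<ge> real (snd \<alpha>)}"
  have "(+) v ` ?X \<subseteq> ?X"
  proof
    fix y assume "y \<in> (+) v ` ?X"
    then obtain \<alpha> s where \<alpha>: "partial_deriv \<alpha> f 0 \<noteq> 0" "y = v + s"
      "real (fst \<alpha>) \<le> fst s" "real (snd \<alpha>) \<le> snd s"
      by auto
    then have "y \<in> {(t1, t2). t1 \<ge> real (fst \<alpha>) \<and> t2 \<ge> real (snd \<alpha>)}"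
      using assms(2,3) by (cases v; cases s) auto
    then show "y \<in> ?X" using \<alpha>(1) by blast
  qed
  then have "convex hull ((+) v ` ?X) \<subseteq> convex hull ?X"
    by (rule hull_mono)
  then show ?thesis
    using assms(1) unfolding newton_polyhedron_def convex_hull_translation by blast
qed

lemma newton_polyhedron_above:
  assumes "t \<in> newton_polyhedron f" "fst t \<le> fst s" "snd t \<le> snd s"
  shows "s \<in> newton_polyhedron f"
  using newton_polyhedron_translate[OF assms(1), of "s - t"] assms(2,3) by simp

lemma newton_polyhedron_exponent:
  "partial_deriv \<alpha> f 0 \<noteq> 0 \<Longrightarrow> (real (fst \<alpha>), real (snd \<alpha>)) \<in> newton_polyhedron f"
  unfolding newton_polyhedron_def by (rule hull_inc, rule UN_I[of \<alpha>]) auto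

lemma newton_polyhedron_interior:
  assumes "t \<in> newton_polyhedron f" "fst t < fst s" "snd t < snd s"
  shows "s \<in> interior (newton_polyhedron f)"
proof (rule interiorI)
  show "open ({fst t<..} \<times> {snd t<..})"
    by (intro open_Times) auto
  show "s \<in> {fst t<..} \<times> {snd t<..}"
    using assms(2,3) by (cases s) auto
  show "{fst t<..} \<times> {snd t<..} \<subseteq> newton_polyhedron f"
    using newton_polyhedron_above[OF assms(1)] by auto
qed

lemma newton_polyhedron_proper_face:
  assumes "is_vertex F (newton_polyhedron f) \<or> is_edge F (newton_polyhedron f)"
  shows "F face_of newton_polyhedron f" "F \<noteq> newton_polyhedron f"
proof -
  show F: "F face_of newton_polyhedron f"
    using assms by (auto simp: is_vertex_def is_edge_def)
  show "F \<noteq> newton_polyhedron f"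
  proof
    assume eq: "F = newton_polyhedron f"
    have dim: "aff_dim F = 0 \<or> aff_dim F = 1"
      using assms by (auto simp: is_vertex_def is_edge_def)
    then have "F \<noteq> {}" by auto
    then obtain t where "t \<in> newton_polyhedron f" using eq by auto
    then have "t + (1, 1) \<in> interior (newton_polyhedron f)"
      by (rule newton_polyhedron_interior) auto
    then have "aff_dim F = int DIM(real \<times> real)"
      using eq by (intro aff_dim_nonempty_interior) auto
    then show False using dim by simp
  qed
qed

text \<open>The description that defines the Newton distance determines it: if \<open>(d, d)\<close> and \<open>(d', d')\<close> lie on
  proper faces and \<open>d < d'\<close>, then \<open>(d', d')\<close> is an interior point of the polyhedron, which no proper
  face contains.\<close>

lemma newton_distance_eq:
  assumes "is_principal_face F (newton_polyhedron f)" "(d, d) \<in> F"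
  shows "newton_distance f = d"
  unfolding newton_distance_def
proof (rule the_equality)
  show "\<exists>F. is_principal_face F (newton_polyhedron f) \<and> (d, d) \<in> F"
    using assms by blast
next
  have le: "d' \<le> d" if "is_principal_face F (newton_polyhedron f)" "(d, d) \<in> newton_polyhedron f"
    "(d', d') \<in> F" for F d d'
  proof (rule ccontr)
    assume "\<not> d' \<le> d"
    then have "(d', d') \<in> interior (newton_polyhedron f)"
      using newton_polyhedron_interior[OF that(2)] by simp
    moreover have "F \<inter> interior (newton_polyhedron f) = {}"
      using that(1) newton_polyhedron_proper_face[of F f]
      by (intro face_of_disjoint_interior) (auto simp: is_principal_face_def)
    ultimately show False using that(3) by blast
  qed
  have sub: "F \<subseteq> newton_polyhedron f" if "is_principal_face F (newton_polyhedron f)" for F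
    using that newton_polyhedron_proper_face(1)[of F f] face_of_imp_subset
    by (auto simp: is_principal_face_def)
  show "d' = d" if "\<exists>F. is_principal_face F (newton_polyhedron f) \<and> (d', d') \<in> F" for d'
  proof -
    from that obtain F' where F': "is_principal_face F' (newton_polyhedron f)" "(d', d') \<in> F'"
      by (elim exE conjE)
    have "d' \<le> d" using le[OF F'(1) _ F'(2)] sub[OF assms(1)] assms(2) by blast
    moreover have "d \<le> d'" using le[OF assms(1) _ assms(2)] sub[OF F'(1)] F'(2) by blast
    ultimately show ?thesis by simp
  qed
qed

text \<open>A supporting line of the polyhedron at a relative interior point of the edge has to contain the
  whole edge, so it is \<^term>\<open>weight_line \<kappa>\<close>; and the polyhedron lies above it because it is closed
  under adding vectors with nonnegative coordinates.\<close>

lemma weight_line_edge_supports: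
  assumes E: "is_edge E (newton_polyhedron f)" "E \<subseteq> weight_line \<kappa>"
    and \<kappa>: "0 \<le> fst \<kappa>" "0 \<le> snd \<kappa>" and t: "t \<in> newton_polyhedron f"
  shows "1 \<le> fst \<kappa> * fst t + snd \<kappa> * snd t"
proof -
  let ?N = "newton_polyhedron f"
  have face: "E face_of ?N" "E \<noteq> ?N" "aff_dim E = 1"
    using newton_polyhedron_proper_face[of E f] E by (auto simp: is_edge_def)
  have cE: "convex E" using face(1) by (rule face_of_imp_convex)
  have "E \<noteq> {}" using face(3) by auto
  then obtain x where x: "x \<in> rel_interior E"
    using cE rel_interior_eq_empty by blast
  then have xE: "x \<in> E" using rel_interior_subset by blast
  have "\<not> E \<subseteq> {x}"
    using aff_dim_subset[of E "{x}"] face(3) by auto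
  then obtain y where y: "y \<in> E" "y \<noteq> x" by blast
  have EN: "E \<subseteq> ?N" using face(1) by (rule face_of_imp_subset)
  have nx: "x \<notin> rel_interior ?N"
    using face_of_disjoint_rel_interior[OF face(1,2)] xE by blast
  have cN: "convex ?N" and xN: "x \<in> ?N"
    using xE EN by (auto simp: newton_polyhedron_def)
  obtain a where a: "a \<noteq> 0" "\<And>y. y \<in> ?N \<Longrightarrow> a \<bullet> x \<le> a \<bullet> y"
    "\<And>y. y \<in> rel_interior ?N \<Longrightarrow> a \<bullet> x < a \<bullet> y"
    by (rule supporting_hyperplane_rel_boundary[OF cN xN nx]) (rule that; blast)
  have ay: "a \<bullet> y = a \<bullet> x"
  proof -
    \<comment> \<open>The segment from \<open>y\<close> to the relative interior point \<open>x\<close> can be prolonged beyond \<open>x\<close> inside the edge.\<close>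
    obtain e where e: "e > 1" "(1 - e) *\<^sub>R y + e *\<^sub>R x \<in> E"
      using x y(1) unfolding convex_rel_interior_iff[OF cE \<open>E \<noteq> {}\<close>] by blast
    have "a \<bullet> x \<le> (1 - e) * (a \<bullet> y) + e * (a \<bullet> x)"
      using a(2)[of "(1 - e) *\<^sub>R y + e *\<^sub>R x"] e(2) EN by (auto simp: inner_add_right)
    then have "(e - 1) * (a \<bullet> y) \<le> (e - 1) * (a \<bullet> x)"
      by (simp add: algebra_simps)
    then have "a \<bullet> y \<le> a \<bullet> x" using e(1) by simp
    then show ?thesis using a(2)[of y] y(1) EN by force
  qed
  obtain a1 a2 x1 x2 y1 y2 t1 t2 k1 k2 where
    p: "a = (a1, a2)" "x = (x1, x2)" "y = (y1, y2)" "t = (t1, t2)" "\<kappa> = (k1, k2)"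
    by fastforce
  have a0: "a1 \<ge> 0" "a2 \<ge> 0"
    using a(2)[OF newton_polyhedron_translate[of x f "(1, 0)"]]
      a(2)[OF newton_polyhedron_translate[of x f "(0, 1)"]] xE EN
    by (auto simp: p inner_prod_def algebra_simps)
  have kx: "k1 * x1 + k2 * x2 = 1" and ky: "k1 * y1 + k2 * y2 = 1"
    using xE y(1) E(2) by (auto simp: p weight_line_def)
  \<comment> \<open>Both \<open>a\<close> and \<open>\<kappa>\<close> are orthogonal to \<open>y - x \<noteq> 0\<close>, so in the plane they are parallel.\<close>
  have par: "a1 * k2 = a2 * k1"
  proof -
    have w: "a1 * (y1 - x1) + a2 * (y2 - x2) = 0" "k1 * (y1 - x1) + k2 * (y2 - x2) = 0"
      using ay kx ky by (auto simp: p inner_prod_def algebra_simps)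
    have "(a1 * k2 - a2 * k1) * (y1 - x1) = 0" "(a1 * k2 - a2 * k1) * (y2 - x2) = 0"
      using w by algebra+
    moreover have "y1 - x1 \<noteq> 0 \<or> y2 - x2 \<noteq> 0" using y(2) by (auto simp: p)
    ultimately show ?thesis by auto
  qed
  have at: "0 \<le> a1 * (t1 - x1) + a2 * (t2 - x2)"
    using a(2)[OF t] by (simp add: p inner_prod_def algebra_simps)
  have k: "0 \<le> k1" "0 \<le> k2" using \<kappa> by (auto simp: p)
  have "a1 * (k1 * (t1 - x1) + k2 * (t2 - x2)) = k1 * (a1 * (t1 - x1) + a2 * (t2 - x2))"
    "a2 * (k1 * (t1 - x1) + k2 * (t2 - x2)) = k2 * (a1 * (t1 - x1) + a2 * (t2 - x2))"
    using par by algebra+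
  then have "0 \<le> a1 * (k1 * (t1 - x1) + k2 * (t2 - x2))" "0 \<le> a2 * (k1 * (t1 - x1) + k2 * (t2 - x2))"
    using k at by auto
  moreover have "0 < a1 \<or> 0 < a2" using a(1) a0 by (auto simp: p zero_prod_def)
  ultimately have "0 \<le> k1 * (t1 - x1) + k2 * (t2 - x2)"
    by (auto simp: zero_le_mult_iff)
  then show ?thesis using kx by (simp add: p algebra_simps)
qed

lemma principal_weight:
  assumes "is_principal_weight f \<kappa>"
  shows "newton_distance f * (fst \<kappa> + snd \<kappa>) = 1"
    and "\<And>t. t \<in> newton_polyhedron f \<Longrightarrow> 1 \<le> fst \<kappa> * fst t + snd \<kappa> * snd t"
proof -
  let ?N = "newton_polyhedron f"
  obtain F where F: "is_principal_face F ?N" and \<kappa>: "0 \<le> fst \<kappa>" "0 \<le> snd \<kappa>"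
    and edge: "is_edge F ?N \<Longrightarrow> F \<subseteq> weight_line \<kappa>"
    and vert: "is_vertex F ?N \<Longrightarrow>
      \<exists>v E. F = {v} \<and> is_edge E ?N \<and> is_left_endpoint v E \<and> E \<subseteq> weight_line \<kappa>"
    using assms unfolding is_principal_weight_def by blast
  have "is_vertex F ?N \<or> is_edge F ?N"
    using F by (simp add: is_principal_face_def)
  then obtain E where E: "is_edge E ?N" "E \<subseteq> weight_line \<kappa>" "F \<subseteq> E"
    using edge vert by (fastforce simp: is_left_endpoint_def)
  obtain d where d: "(d, d) \<in> F"
    using F by (auto simp: is_principal_face_def meets_bisectrix_def)
  then have "(d, d) \<in> weight_line \<kappa>" using E by blast
  then show "newton_distance f * (fst \<kappa> + snd \<kappa>) = 1"
    using newton_distance_eq[OF F d] by (simp add: weight_line_def algebra_simps)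
  show "\<And>t. t \<in> ?N \<Longrightarrow> 1 \<le> fst \<kappa> * fst t + snd \<kappa> * snd t"
    using weight_line_edge_supports[OF E(1,2) \<kappa>] .
qed

text \<open>The polyhedron is unbounded in the direction \<open>(1, 1)\<close>, so it cannot lie on the side of the line that
  contains the origin.\<close>

lemma supporting_weight_below:
  assumes sup: "is_supporting_weight (u, k) A" and uk: "0 \<le> u" "0 \<le> k"
    and A: "newton_polyhedron g \<subseteq> A" and ne: "newton_polyhedron g \<noteq> {}" and t: "t \<in> A"
  shows "1 \<le> u * fst t + k * snd t"
proof (rule ccontr)
  assume "\<not> 1 \<le> u * fst t + k * snd t"
  then have le: "\<And>t. t \<in> A \<Longrightarrow> u * fst t + k * snd t \<le> 1" and "weight_line (u, k) \<inter> A \<noteq> {}"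
    using sup t by (fastforce simp: is_supporting_weight_def)+
  then have "u \<noteq> 0 \<or> k \<noteq> 0" by (auto simp: weight_line_def)
  then have uk': "u + k > 0" using uk by linarith
  obtain s where s: "s \<in> newton_polyhedron g" using ne by blast
  \<comment> \<open>Moving from \<open>s\<close> by \<open>(c, c)\<close> raises the value of the weight to exactly \<open>2\<close>.\<close>
  define c where "c = (2 - (u * fst s + k * snd s)) / (u + k)"
  have "u * fst s + k * snd s \<le> 1" using le s A by blast
  then have "c \<ge> 0" using uk' by (simp add: c_def)
  then have "(c, c) + s \<in> A" using newton_polyhedron_translate[OF s, of "(c, c)"] A by auto
  then have "u * (c + fst s) + k * (c + snd s) \<le> 1"
    using le[of "(c, c) + s"] by simp
  moreover have "u * (c + fst s) + k * (c + snd s) = c * (u + k) + (u * fst s + k * snd s)"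
    by (simp add: algebra_simps)
  moreover have "c * (u + k) = 2 - (u * fst s + k * snd s)"
    using uk' by (simp add: c_def)
  ultimately show False by linarith
qed

lemma newton_polyhedron_subset_augmented:
  "newton_polyhedron g \<subseteq> augmented_newton_polyhedron \<kappa> g"
  unfolding augmented_newton_polyhedron_def by (rule order_trans[OF Un_upper1 hull_subset])

text \<open>The augmented polyhedron contains an upward ray in direction \<open>(- \<kappa>\<^sub>2, \<kappa>\<^sub>1)\<close>. A linear function that
  is bounded below on it cannot decrease in that direction.\<close>

lemma augmented_weight_slope:
  assumes "0 < fst \<kappa>"
    and below: "\<And>t. t \<in> augmented_newton_polyhedron \<kappa> g \<Longrightarrow> 1 \<le> u * fst t + k * snd t"
  shows "u * snd \<kappa> \<le> k * fst \<kappa>"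
proof (rule ccontr)
  assume "\<not> u * snd \<kappa> \<le> k * fst \<kappa>"
  define D where "D = u * snd \<kappa> - k * fst \<kappa>"
  then have D: "D > 0" using \<open>\<not> u * snd \<kappa> \<le> k * fst \<kappa>\<close> by simp
  \<comment> \<open>High enough on the ray for the value of the linear function to drop below \<open>1\<close>.\<close>
  define s where "s = max (snd (lowest_point \<kappa> (newton_polyhedron g))) (u / D)"
  let ?t = "((1 - snd \<kappa> * s) / fst \<kappa>, s)"
  have "?t \<in> augmented_newton_polyhedron \<kappa> g"
    unfolding augmented_newton_polyhedron_def using assms(1)
    by (intro hull_inc) (auto simp: weight_line_def s_def)
  then have "1 \<le> u * ((1 - snd \<kappa> * s) / fst \<kappa>) + k * s"
    using below by fastforce
  then have "fst \<kappa> \<le> u - D * s"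
    using assms(1) by (simp add: D_def field_simps)
  moreover have "u \<le> D * s"
    using D by (simp add: s_def max_def field_simps split: if_splits)
  ultimately show False using assms(1) by linarith
qed

section \<open>Gaussian test functions\<close>

lemma real_polynomial_function_dir_deriv:
  assumes "real_polynomial_function P"
  shows "(\<forall>x. P differentiable (at x)) \<and> (\<forall>v. real_polynomial_function (dir_deriv v P))"
  using assms
proof induction
  case (linear f)
  then have "(f has_derivative f) (at x)" for x
    by (rule bounded_linear_imp_has_derivative)
  then have "dir_deriv v f = (\<lambda>x. f v)" "f differentiable (at x)" for v x
    by (auto intro!: ext dir_deriv_eq differentiableI)
  then show ?case by auto
next
  case (const c)
  have "dir_deriv v (\<lambda>x. c) = (\<lambda>x::'a. 0)" for v
    by (auto intro!: ext dir_deriv_eq[OF has_derivative_const])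
  then show ?case by auto
next
  case (add f g)
  then have "dir_deriv v (\<lambda>x. f x + g x) = (\<lambda>x. dir_deriv v f x + dir_deriv v g x)" for v
    by (auto intro!: ext dir_deriv_eq has_derivative_add has_derivative_dir_deriv)
  then show ?case using add by auto
next
  case (mult f g)
  then have "dir_deriv v (\<lambda>x. f x * g x) = (\<lambda>x. f x * dir_deriv v g x + dir_deriv v f x * g x)" for v
    by (auto intro!: ext dir_deriv_eq has_derivative_mult has_derivative_dir_deriv)
  then show ?case using mult by (auto intro!: real_polynomial_function.intros(3,4))
qed

lemma real_polynomial_function_growth:
  assumes "real_polynomial_function P"
  shows "\<exists>C\<ge>0. \<exists>n. \<forall>x. \<bar>P x\<bar> \<le> C * (1 + norm x) ^ n"
  using assms
proof induction
  case (linear f)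
  then obtain K where K: "\<And>x. norm (f x) \<le> norm x * K"
    using bounded_linear.bounded by blast
  have "\<bar>f x\<bar> \<le> \<bar>K\<bar> * (1 + norm x) ^ 1" for x
  proof -
    have "norm x * K \<le> norm x * \<bar>K\<bar>"
      by (intro mult_left_mono) auto
    then have "\<bar>f x\<bar> \<le> norm x * \<bar>K\<bar>"
      using K[of x] by simp
    also have "\<dots> \<le> (1 + norm x) * \<bar>K\<bar>"
      by (intro mult_right_mono) auto
    finally show ?thesis by (simp add: mult.commute)
  qed
  then show ?case by (intro exI[of _ "\<bar>K\<bar>"] exI[of _ 1] conjI allI) auto
next
  case (const c)
  have "\<bar>c\<bar> \<le> \<bar>c\<bar> * (1 + norm x) ^ 0" for x :: 'a by simp
  then show ?case by (intro exI[of _ "\<bar>c\<bar>"] exI[of _ 0] conjI allI) auto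
next
  case (add f g)
  then obtain C n D m where C: "C \<ge> 0" "\<And>x. \<bar>f x\<bar> \<le> C * (1 + norm x) ^ n"
    and D: "D \<ge> 0" "\<And>x. \<bar>g x\<bar> \<le> D * (1 + norm x) ^ m" by blast
  have "\<bar>f x + g x\<bar> \<le> (C + D) * (1 + norm x) ^ (n + m)" for x
  proof -
    have "\<bar>f x + g x\<bar> \<le> C * (1 + norm x) ^ n + D * (1 + norm x) ^ m"
      using C(2)[of x] D(2)[of x] by linarith
    also have "\<dots> \<le> C * (1 + norm x) ^ (n + m) + D * (1 + norm x) ^ (n + m)"
      using C(1) D(1) by (intro add_mono mult_left_mono power_increasing) auto
    finally show ?thesis by (simp add: algebra_simps)
  qed
  then show ?case
    using C(1) D(1) by (intro exI[of _ "C + D"] exI[of _ "n + m"] conjI allI) auto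
next
  case (mult f g)
  then obtain C n D m where C: "C \<ge> 0" "\<And>x. \<bar>f x\<bar> \<le> C * (1 + norm x) ^ n"
    and D: "D \<ge> 0" "\<And>x. \<bar>g x\<bar> \<le> D * (1 + norm x) ^ m" by blast
  have "\<bar>f x * g x\<bar> \<le> (C * D) * (1 + norm x) ^ (n + m)" for x
  proof -
    have "\<bar>f x * g x\<bar> \<le> (C * (1 + norm x) ^ n) * (D * (1 + norm x) ^ m)"
      unfolding abs_mult using C D by (intro mult_mono) auto
    then show ?thesis by (simp add: power_add algebra_simps)
  qed
  then show ?case
    using C(1) D(1) by (intro exI[of _ "C * D"] exI[of _ "n + m"] conjI allI) auto
qed

text \<open>Polynomial multiples of \<open>exp (- Q)\<close>, with a polynomial \<open>Q\<close>, are closed under differentiation, so all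
  derivatives of a Gaussian can be treated at once.\<close>

lemma dir_deriv_polynomial_exp:
  assumes "real_polynomial_function P" "real_polynomial_function Q"
  defines "f \<equiv> \<lambda>x. complex_of_real (P x * exp (- Q x))"
  shows "f differentiable (at x)"
    and "dir_deriv v f = (\<lambda>x. complex_of_real ((dir_deriv v P x - P x * dir_deriv v Q x) * exp (- Q x)))"
proof -
  have "(f has_derivative
      (\<lambda>v. complex_of_real ((dir_deriv v P x - P x * dir_deriv v Q x) * exp (- Q x)))) (at x)" for x
  proof -
    have P: "(P has_derivative (\<lambda>v. dir_deriv v P x)) (at x)"
      and Q: "(Q has_derivative (\<lambda>v. dir_deriv v Q x)) (at x)"
      using real_polynomial_function_dir_deriv assms has_derivative_dir_deriv by blast+
    have "((\<lambda>x. P x * exp (- Q x)) has_derivative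
        (\<lambda>v. (dir_deriv v P x - P x * dir_deriv v Q x) * exp (- Q x))) (at x)"
      by (rule derivative_eq_intros P Q refl)+ (simp add: algebra_simps)
    then show ?thesis unfolding f_def by (rule has_derivative_of_real)
  qed
  note D = this
  show "f differentiable (at x)"
    using D by (rule differentiableI)
  show "dir_deriv v f = (\<lambda>x. complex_of_real ((dir_deriv v P x - P x * dir_deriv v Q x) * exp (- Q x)))"
    by (rule ext, rule dir_deriv_eq, rule D)
qed

lemma polynomial_dir_deriv_exp_factor:
  assumes "real_polynomial_function P" "real_polynomial_function Q"
  shows "real_polynomial_function (\<lambda>x. dir_deriv v P x - P x * dir_deriv v Q x)"
  using assms real_polynomial_function_dir_deriv
  by (intro real_polynomial_function_diff real_polynomial_function.intros(4)) auto

lemma ck_on_polynomial_exp: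
  assumes "real_polynomial_function P" "real_polynomial_function Q"
  shows "ck_on k UNIV (\<lambda>x. complex_of_real (P x * exp (- Q x)))"
  using assms(1)
proof (induction k arbitrary: P)
  case 0
  then show ?case
    using dir_deriv_polynomial_exp(1)[OF 0 assms(2)]
    by (auto intro!: continuous_at_imp_continuous_on differentiable_imp_continuous_within)
next
  case (Suc k)
  show ?case
    using dir_deriv_polynomial_exp[OF Suc.prems assms(2)]
      Suc.IH[OF polynomial_dir_deriv_exp_factor[OF Suc.prems assms(2)]]
    by auto
qed

lemma foldr_dir_deriv_polynomial_exp:
  assumes "real_polynomial_function P" "real_polynomial_function Q"
  shows "\<exists>R. real_polynomial_function R \<and>
    foldr dir_deriv vs (\<lambda>x. complex_of_real (P x * exp (- Q x))) =
      (\<lambda>x. complex_of_real (R x * exp (- Q x)))"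
proof (induction vs)
  case Nil
  then show ?case using assms by auto
next
  case (Cons v vs)
  then obtain R where R: "real_polynomial_function R" "foldr dir_deriv vs
      (\<lambda>x. complex_of_real (P x * exp (- Q x))) = (\<lambda>x. complex_of_real (R x * exp (- Q x)))"
    by blast
  show ?case
    using dir_deriv_polynomial_exp(2)[OF R(1) assms(2), of v]
      polynomial_dir_deriv_exp_factor[OF R(1) assms(2), of v] R(2) by auto
qed

text \<open>By \<open>1 + r \<le> exp r\<close>, a factor \<open>(1 + r)^K\<close> is at most \<open>exp (K r)\<close>, and \<open>K r - \<delta> r\<^sup>2\<close> is
  bounded above.\<close>

lemma schwartz_polynomial_exp:
  fixes P Q :: "'a::euclidean_space \<Rightarrow> real"
  assumes P: "real_polynomial_function P" and Q: "real_polynomial_function Q"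
    and "0 < \<delta>" and coercive: "\<And>x. \<delta> * (norm x)\<^sup>2 \<le> Q x"
  shows "schwartz (\<lambda>x. complex_of_real (P x * exp (- Q x)))"
proof -
  have "bounded (range (\<lambda>x. (1 + norm x) ^ N *\<^sub>R foldr dir_deriv vs (\<lambda>x. complex_of_real (P x * exp (- Q x))) x))"
    for N vs
  proof -
    obtain R where R: "real_polynomial_function R" "foldr dir_deriv vs
      (\<lambda>x. complex_of_real (P x * exp (- Q x))) = (\<lambda>x. complex_of_real (R x * exp (- Q x)))"
      using foldr_dir_deriv_polynomial_exp[OF P Q] by blast
    obtain C n where C: "C \<ge> 0" "\<And>x. \<bar>R x\<bar> \<le> C * (1 + norm x) ^ n"
      using real_polynomial_function_growth[OF R(1)] by blast
    define K where "K = real (N + n)"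
    have "norm ((1 + norm x) ^ N *\<^sub>R complex_of_real (R x * exp (- Q x))) \<le> C * exp (K\<^sup>2 / (4 * \<delta>))" for x
    proof -
      let ?r = "norm x"
      have "(1 + ?r) ^ (N + n) \<le> exp ?r ^ (N + n)"
        by (intro power_mono exp_ge_add_one_self) auto
      also have "\<dots> = exp (K * ?r)"
        unfolding K_def exp_of_nat_mult ..
      finally have pw: "(1 + ?r) ^ (N + n) \<le> exp (K * ?r)" .
      \<comment> \<open>Completing the square gives the maximum \<open>K\<^sup>2 / (4 \<delta>)\<close> of \<open>K r - \<delta> r\<^sup>2\<close>.\<close>
      have "0 \<le> (2 * \<delta> * ?r - K)\<^sup>2" by simp
      then have "4 * \<delta> * (K * ?r - \<delta> * ?r\<^sup>2) \<le> K\<^sup>2"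
        by (simp add: power2_eq_square algebra_simps)
      then have "K * ?r - \<delta> * ?r\<^sup>2 \<le> K\<^sup>2 / (4 * \<delta>)"
        using \<open>0 < \<delta>\<close> by (simp add: field_simps)
      then have ex: "K * ?r - Q x \<le> K\<^sup>2 / (4 * \<delta>)"
        using coercive[of x] by linarith
      have "norm ((1 + ?r) ^ N *\<^sub>R complex_of_real (R x * exp (- Q x))) = (1 + ?r) ^ N * \<bar>R x\<bar> * exp (- Q x)"
        unfolding norm_scaleR norm_of_real abs_mult by (simp add: abs_of_nonneg)
      also have "\<dots> \<le> (1 + ?r) ^ N * (C * (1 + ?r) ^ n) * exp (- Q x)"
        using C(2)[of x] by (intro mult_right_mono mult_left_mono) auto
      also have "\<dots> = C * ((1 + ?r) ^ (N + n) * exp (- Q x))"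
        by (simp add: power_add)
      also have "\<dots> \<le> C * (exp (K * ?r) * exp (- Q x))"
        using C(1) pw by (intro mult_left_mono mult_right_mono) auto
      also have "\<dots> \<le> C * exp (K\<^sup>2 / (4 * \<delta>))"
        using C(1) ex by (intro mult_left_mono) (auto simp: mult_exp_exp)
      finally show ?thesis .
    qed
    then show ?thesis unfolding R(2) by (intro boundedI) auto
  qed
  then show ?thesis
    using ck_on_polynomial_exp[OF P Q] by (simp add: schwartz_def smooth_on_def)
qed

definition gaussian :: "real \<Rightarrow> real \<Rightarrow> real"
  where "gaussian a x = exp (- (a * x)\<^sup>2 / 2)"

lemma gaussian_pos: "0 < gaussian a x"
  by (simp add: gaussian_def)

lemma gaussian_measurable [measurable]: "gaussian a \<in> borel_measurable borel"
  unfolding gaussian_def by measurable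

lemma gaussian_powr: "0 < q \<Longrightarrow> gaussian a x powr q = gaussian (a * sqrt q) x"
  by (simp add: gaussian_def powr_def power_mult_distrib)

lemma gaussian_integral:
  assumes "0 < a"
  shows "integrable lborel (gaussian a)" "(\<integral>x. gaussian a x \<partial>lborel) = sqrt (2 * pi) / a"
proof -
  have eq: "gaussian a = (\<lambda>x. sqrt (2 * pi) / a * normal_density 0 (1 / a) x)"
    using assms by (auto simp: gaussian_def normal_density_def power_divide real_sqrt_divide power_mult_distrib)
  show "integrable lborel (gaussian a)" "(\<integral>x. gaussian a x \<partial>lborel) = sqrt (2 * pi) / a"
    unfolding eq using assms by (auto simp: integrable_normal_density)
qed

text \<open>This is the characteristic function of the standard normal distribution after the substitution
  \<open>x \<mapsto> a x\<close>.\<close>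

lemma gaussian_fourier:
  assumes "0 < a"
  shows "(\<integral>x. exp (- \<i> * complex_of_real (x * \<xi>)) * complex_of_real (gaussian a x) \<partial>lborel)
    = complex_of_real (sqrt (2 * pi) / a * gaussian (1 / a) \<xi>)"
proof -
  let ?t = "- \<xi> / a"
  have "char std_normal_distribution ?t = (\<integral>x. std_normal_density x *\<^sub>R iexp (?t * x) \<partial>lborel)"
    unfolding char_def by (subst integral_density) auto
  also have "\<dots> = \<bar>a\<bar> *\<^sub>R (\<integral>x. std_normal_density (0 + a * x) *\<^sub>R iexp (?t * (0 + a * x)) \<partial>lborel)"
    using assms by (intro lborel_integral_real_affine) auto
  also have "(\<lambda>x. std_normal_density (0 + a * x) *\<^sub>R iexp (?t * (0 + a * x))) =
      (\<lambda>x. complex_of_real (1 / sqrt (2 * pi)) *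
        (exp (- \<i> * complex_of_real (x * \<xi>)) * complex_of_real (gaussian a x)))"
    using assms by (auto simp: fun_eq_iff normal_density_def gaussian_def scaleR_conv_of_real mult_ac)
  finally have "char std_normal_distribution ?t = complex_of_real (a / sqrt (2 * pi)) *
     (\<integral>x. exp (- \<i> * complex_of_real (x * \<xi>)) * complex_of_real (gaussian a x) \<partial>lborel)"
    using assms by (simp add: scaleR_conv_of_real)
  moreover have "char std_normal_distribution ?t = complex_of_real (gaussian (1 / a) \<xi>)"
    by (simp add: char_std_normal_distribution gaussian_def power_divide)
  ultimately show ?thesis
    using assms by (simp add: field_simps)
qed

lemma lborel_integral_product:
  fixes f :: "'a::euclidean_space \<Rightarrow> 'c::{banach, second_countable_topology, real_normed_field}"
    and g :: "'b::euclidean_space \<Rightarrow> 'c"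
  assumes f: "integrable lborel f" and g: "integrable lborel g"
  shows "integrable lborel (\<lambda>z. f (fst z) * g (snd z))"
    and "(\<integral>z. f (fst z) * g (snd z) \<partial>lborel) = (\<integral>x. f x \<partial>lborel) * (\<integral>y. g y \<partial>lborel)"
proof -
  have [measurable]: "f \<in> borel_measurable borel" "g \<in> borel_measurable borel"
    using f g by auto
  have i: "integrable (lborel \<Otimes>\<^sub>M lborel) (\<lambda>z. f (fst z) * g (snd z))"
  proof (rule lborel_pair.Fubini_integrable)
    show "integrable lborel (\<lambda>x. \<integral>y. norm (f (fst (x, y)) * g (snd (x, y))) \<partial>lborel)"
      using f g by (simp add: norm_mult)
    show "AE x in lborel. integrable lborel (\<lambda>y. f (fst (x, y)) * g (snd (x, y)))"
      using g by simp
  qed measurable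
  then show "integrable lborel (\<lambda>z. f (fst z) * g (snd z))"
    by (simp add: lborel_prod)
  show "(\<integral>z. f (fst z) * g (snd z) \<partial>lborel) = (\<integral>x. f x \<partial>lborel) * (\<integral>y. g y \<partial>lborel)"
    using lborel_pair.integral_fst'[OF i] by (simp add: lborel_prod)
qed

text \<open>Homogeneity, in a form that lets the two functions have different codomains. In a mixed norm of a
  product this pulls out the factor that depends on the outer variable only.\<close>

lemma norm_proportional_lp_norm:
  assumes "1 \<le> p" "0 \<le> c" "\<And>x. norm (h x) = c * norm (f x)"
  shows "lp_norm p h = c * lp_norm p f"
proof (cases "p = \<infinity>")
  case True
  show ?thesis
  proof (cases "c = 0")
    case c0: True
    then show ?thesis
      using assms(3) True by (simp add: lp_norm_def esssup_const flip: zero_ereal_def)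
  next
    case False
    then have "esssup lborel (\<lambda>x. ereal c * ereal (norm (f x))) = ereal c * esssup lborel (\<lambda>x. ereal (norm (f x)))"
      using assms(2) by (intro esssup_cmult) auto
    then show ?thesis
      using assms(3) True by (simp add: lp_norm_def)
  qed
next
  case False
  then obtain q where q: "p = ennreal q" "q \<ge> 1"
    using assms(1) by (cases p) (auto simp flip: ennreal_1)
  have "(\<integral>x. norm (h x) powr q \<partial>lborel) = c powr q * (\<integral>x. norm (f x) powr q \<partial>lborel)"
    using assms by (simp add: powr_mult)
  then show ?thesis
    using q assms(2) False by (simp add: lp_norm_def powr_mult powr_powr)
qed

lemma lp_norm_nonneg: "0 \<le> lp_norm p f"
proof (cases "p = \<infinity> \<and> (\<lambda>x. ereal (norm (f x))) \<in> borel_measurable lborel")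
  case True
  then have "esssup lborel (\<lambda>x::'a. 0) \<le> esssup lborel (\<lambda>x. ereal (norm (f x)))"
    by (intro esssup_mono) auto
  then show ?thesis
    using True by (simp add: lp_norm_def esssup_const real_of_ereal_pos)
next
  case False
  then show ?thesis
    by (auto simp: lp_norm_def esssup_non_measurable top_ereal_def)
qed

lemma lp_norm_le_one_infinity:
  assumes "f \<in> borel_measurable borel" "\<And>x. norm (f x) \<le> 1"
  shows "lp_norm \<infinity> f \<le> 1"
proof -
  have "esssup lborel (\<lambda>x. ereal (norm (f x))) \<le> 1"
    using assms by (intro esssup_I) auto
  then show ?thesis
    by (auto simp: lp_norm_def real_of_ereal_le_1)
qed

definition gaussian2 :: "real \<Rightarrow> real \<Rightarrow> real \<times> real \<Rightarrow> real"
  where "gaussian2 a b x = gaussian a (fst x) * gaussian b (snd x)"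

lemma gaussian2_measurable: "gaussian2 a b \<in> borel_measurable borel"
  unfolding gaussian2_def gaussian_def
  by (intro borel_measurable_continuous_onI continuous_intros) auto

text \<open>Scaling. Stated with \<open>1 / p\<close> as a real number, the exponent is \<open>0\<close> for \<open>p = \<infinity>\<close>.\<close>

lemma lp_norm_gaussian:
  assumes "1 \<le> p"
  shows "\<exists>K\<ge>0. \<forall>a>0. lp_norm p (gaussian a) \<le> K * a powr (- enn2real (1 / p))"
proof (cases "p = \<infinity>")
  case True
  have "lp_norm p (gaussian a) \<le> 1" for a
    unfolding True by (intro lp_norm_le_one_infinity) (auto simp: gaussian_def)
  then show ?thesis using True by (intro exI[of _ 1]) auto
next
  case False
  then obtain q where q: "p = ennreal q" "q \<ge> 1"
    using assms(1) by (cases p) (auto simp flip: ennreal_1)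
  have r: "enn2real (1 / p) = 1 / q"
    using q divide_ennreal[of 1 q] by simp
  have "lp_norm p (gaussian a) = sqrt (2 * pi / q) powr (1 / q) * a powr (- (1 / q))" if "a > 0" for a
  proof -
    have "lp_norm p (gaussian a) = (sqrt (2 * pi) / (a * sqrt q)) powr (1 / q)"
      using q that gaussian_integral(2)[of "a * sqrt q"] gaussian_pos[of a]
      by (simp add: lp_norm_def gaussian_powr less_imp_le)
    also have "\<dots> = (sqrt (2 * pi / q) * inverse a) powr (1 / q)"
      by (simp add: real_sqrt_divide field_simps)
    finally show ?thesis
      using that q by (simp add: powr_mult powr_minus inverse_powr)
  qed
  then show ?thesis
    unfolding r by (intro exI[of _ "sqrt (2 * pi / q) powr (1 / q)"]) auto
qed

lemma lp_norm_gaussian2: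
  assumes "1 \<le> p"
  shows "\<exists>K\<ge>0. \<forall>a>0. \<forall>b>0. lp_norm p (gaussian2 a b) \<le> K * (a * b) powr (- enn2real (1 / p))"
proof (cases "p = \<infinity>")
  case True
  have "lp_norm p (gaussian2 a b) \<le> 1" for a b
    unfolding True
    by (intro lp_norm_le_one_infinity gaussian2_measurable)
      (auto simp: gaussian2_def gaussian_def mult_exp_exp)
  then show ?thesis using True by (intro exI[of _ 1]) (auto simp: less_imp_neq[THEN not_sym])
next
  case False
  then obtain q where q: "p = ennreal q" "q \<ge> 1"
    using assms(1) by (cases p) (auto simp flip: ennreal_1)
  have r: "enn2real (1 / p) = 1 / q"
    using q divide_ennreal[of 1 q] by simp
  have "lp_norm p (gaussian2 a b) = (2 * pi / q) powr (1 / q) * (a * b) powr (- (1 / q))"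
    if "a > 0" "b > 0" for a b
  proof -
    have "lp_norm p (gaussian2 a b) =
        (\<integral>x. gaussian (a * sqrt q) (fst x) * gaussian (b * sqrt q) (snd x) \<partial>lborel) powr (1 / q)"
      using q gaussian_pos[of a] gaussian_pos[of b]
      by (simp add: lp_norm_def gaussian2_def abs_mult less_imp_le powr_mult gaussian_powr)
    also have "\<dots> = ((sqrt (2 * pi) / (a * sqrt q)) * (sqrt (2 * pi) / (b * sqrt q))) powr (1 / q)"
      using q that by (subst lborel_integral_product(2)) (auto intro!: gaussian_integral simp: gaussian_integral(2))
    also have "\<dots> = (2 * pi / q * inverse (a * b)) powr (1 / q)"
      using q by (simp add: field_simps)
    also have "\<dots> = (2 * pi / q) powr (1 / q) * inverse (a * b) powr (1 / q)"
      by (rule powr_mult)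
    finally show ?thesis
      using that q by (simp only: powr_minus inverse_powr mult_nonneg_nonneg less_imp_le)
  qed
  then show ?thesis
    unfolding r by (intro exI[of _ "(2 * pi / q) powr (1 / q)"]) auto
qed

text \<open>The test function: concentrated on a box with sides \<open>1 / a\<close>, \<open>1 / b\<close>, \<open>1 / c\<close>, so that its Fourier
  transform is concentrated on the dual box with sides \<open>a\<close>, \<open>b\<close>, \<open>c\<close>.\<close>

definition gaussian3 :: "real \<Rightarrow> real \<Rightarrow> real \<Rightarrow> (real \<times> real) \<times> real \<Rightarrow> complex"
  where "gaussian3 a b c x = complex_of_real (gaussian2 a b (fst x) * gaussian c (snd x))"

lemma mixed_norm_gaussian3:
  assumes "1 \<le> p1" "1 \<le> p3"
  shows "mixed_norm p1 p3 (gaussian3 a b c) = lp_norm p1 (gaussian2 a b) * lp_norm p3 (gaussian c)"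
proof -
  have "lp_norm p1 (\<lambda>x. gaussian3 a b c (x, x3)) = gaussian c x3 * lp_norm p1 (gaussian2 a b)" for x3
    using assms(1) gaussian_pos[of c]
    by (intro norm_proportional_lp_norm) (auto simp: gaussian3_def norm_mult less_imp_le)
  then show ?thesis
    unfolding mixed_norm_def using assms(2) lp_norm_nonneg[of p1 "gaussian2 a b"]
    by (simp add: norm_proportional_lp_norm[of p3 "lp_norm p1 (gaussian2 a b)" _ "gaussian c"] abs_mult)
qed

lemma mixed_norm_gaussian3_bound:
  assumes "1 \<le> p1" "1 \<le> p3"
  shows "\<exists>K\<ge>0. \<forall>a>0. \<forall>b>0. \<forall>c>0. mixed_norm p1 p3 (gaussian3 a b c)
    \<le> K * (a * b) powr (- enn2real (1 / p1)) * c powr (- enn2real (1 / p3))"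
proof -
  obtain K1 where K1: "K1 \<ge> 0"
    "\<forall>a>0. \<forall>b>0. lp_norm p1 (gaussian2 a b) \<le> K1 * (a * b) powr (- enn2real (1 / p1))"
    using lp_norm_gaussian2[OF assms(1)] by blast
  obtain K3 where K3: "K3 \<ge> 0" "\<forall>a>0. lp_norm p3 (gaussian a) \<le> K3 * a powr (- enn2real (1 / p3))"
    using lp_norm_gaussian[OF assms(2)] by blast
  have "mixed_norm p1 p3 (gaussian3 a b c)
    \<le> K1 * K3 * (a * b) powr (- enn2real (1 / p1)) * c powr (- enn2real (1 / p3))"
    if "a > 0" "b > 0" "c > 0" for a b c
  proof -
    have "mixed_norm p1 p3 (gaussian3 a b c)
        \<le> (K1 * (a * b) powr (- enn2real (1 / p1))) * (K3 * c powr (- enn2real (1 / p3)))"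
      unfolding mixed_norm_gaussian3[OF assms]
      using K1 K3 that by (intro mult_mono lp_norm_nonneg) auto
    then show ?thesis by (simp add: algebra_simps)
  qed
  then show ?thesis using K1 K3 by (intro exI[of _ "K1 * K3"]) auto
qed

lemma fourier_gaussian3:
  assumes "a > 0" "b > 0" "c > 0"
  shows "fourier (gaussian3 a b c) \<xi> = complex_of_real ((2 * pi) powr (3/2) / (a * b * c) *
    (gaussian2 (1 / a) (1 / b) (fst \<xi>) * gaussian (1 / c) (snd \<xi>)))"
proof -
  let ?e = "\<lambda>a \<xi> x. exp (- \<i> * complex_of_real (x * \<xi>)) * complex_of_real (gaussian a x)"
  have int: "integrable lborel (?e a \<xi>)" if "a > 0" for a \<xi>
    by (rule Bochner_Integration.integrable_bound[OF gaussian_integral(1)[OF that]])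
      (auto simp: norm_mult)
  have "(\<lambda>x. exp (- \<i> * complex_of_real (x \<bullet> \<xi>)) * gaussian3 a b c x) =
     (\<lambda>x. (\<lambda>y. ?e a (fst (fst \<xi>)) (fst y) * ?e b (snd (fst \<xi>)) (snd y)) (fst x) * ?e c (snd \<xi>) (snd x))"
  proof (rule ext)
    fix x :: "(real \<times> real) \<times> real"
    have "- \<i> * complex_of_real (x \<bullet> \<xi>) = - \<i> * complex_of_real (fst (fst x) * fst (fst \<xi>)) +
        - \<i> * complex_of_real (snd (fst x) * snd (fst \<xi>)) + - \<i> * complex_of_real (snd x * snd \<xi>)"
      by (simp add: inner_prod_def algebra_simps)
    then show "exp (- \<i> * complex_of_real (x \<bullet> \<xi>)) * gaussian3 a b c x =
        (\<lambda>y. ?e a (fst (fst \<xi>)) (fst y) * ?e b (snd (fst \<xi>)) (snd y)) (fst x) * ?e c (snd \<xi>) (snd x)"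
      by (simp only: exp_add gaussian3_def gaussian2_def of_real_mult mult_ac)
  qed
  note split = this
  have "fourier (gaussian3 a b c) \<xi> =
      (\<integral>x. ?e a (fst (fst \<xi>)) x \<partial>lborel) * (\<integral>x. ?e b (snd (fst \<xi>)) x \<partial>lborel) * (\<integral>x. ?e c (snd \<xi>) x \<partial>lborel)"
    unfolding fourier_def split
      lborel_integral_product(2)[OF lborel_integral_product(1)[OF int[OF assms(1)] int[OF assms(2)]] int[OF assms(3)]]
      lborel_integral_product(2)[OF int[OF assms(1)] int[OF assms(2)]] ..
  also have "\<dots> =
    complex_of_real (sqrt (2 * pi) / a * gaussian (1 / a) (fst (fst \<xi>))) *
    complex_of_real (sqrt (2 * pi) / b * gaussian (1 / b) (snd (fst \<xi>))) *
    complex_of_real (sqrt (2 * pi) / c * gaussian (1 / c) (snd \<xi>))"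
    by (simp only: gaussian_fourier assms)
  also have "\<dots> = complex_of_real (sqrt (2 * pi) * sqrt (2 * pi) * sqrt (2 * pi) / (a * b * c) *
    (gaussian2 (1 / a) (1 / b) (fst \<xi>) * gaussian (1 / c) (snd \<xi>)))"
    unfolding of_real_mult[symmetric] gaussian2_def
    by (simp only: times_divide_eq_left times_divide_eq_right divide_divide_eq_left mult_ac)
  also have "sqrt (2 * pi) * sqrt (2 * pi) * sqrt (2 * pi) = (2 * pi) powr (1/2 + 1/2 + 1/2)"
    unfolding powr_add by (simp only: powr_half_sqrt[of "2 * pi"] pi_ge_zero mult_nonneg_nonneg zero_le_numeral)
  finally show ?thesis by simp
qed

lemma schwartz_gaussian3:
  assumes "a > 0" "b > 0" "c > 0"
  shows "schwartz (gaussian3 a b c)"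
proof -
  let ?Q = "\<lambda>x::(real \<times> real) \<times> real.
    a\<^sup>2 / 2 * (fst (fst x) * fst (fst x)) + b\<^sup>2 / 2 * (snd (fst x) * snd (fst x)) + c\<^sup>2 / 2 * (snd x * snd x)"
  let ?d = "min (a\<^sup>2 / 2) (min (b\<^sup>2 / 2) (c\<^sup>2 / 2))"
  have "real_polynomial_function ?Q"
    by (intro real_polynomial_function.intros bounded_linear_fst_comp bounded_linear_snd_comp
        bounded_linear_compose[OF bounded_linear_fst bounded_linear_fst]
        bounded_linear_compose[OF bounded_linear_snd bounded_linear_fst]
        bounded_linear_snd)
  moreover have "?d * (norm x)\<^sup>2 \<le> ?Q x" for x
  proof -
    have "(norm x)\<^sup>2 = fst (fst x) * fst (fst x) + snd (fst x) * snd (fst x) + snd x * snd x"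
      by (simp add: power2_norm_eq_inner inner_prod_def)
    moreover have "?d * (fst (fst x) * fst (fst x)) \<le> a\<^sup>2 / 2 * (fst (fst x) * fst (fst x))"
      "?d * (snd (fst x) * snd (fst x)) \<le> b\<^sup>2 / 2 * (snd (fst x) * snd (fst x))"
      "?d * (snd x * snd x) \<le> c\<^sup>2 / 2 * (snd x * snd x)"
      by (intro mult_right_mono; simp)+
    ultimately show ?thesis by (simp only: distrib_left)
  qed
  ultimately have "schwartz (\<lambda>x. complex_of_real (1 * exp (- ?Q x)))"
    using assms by (intro schwartz_polynomial_exp[of _ _ ?d] real_polynomial_function.intros(2)) auto
  moreover have "1 * exp (- ?Q x) = gaussian2 a b (fst x) * gaussian c (snd x)" for x
    unfolding gaussian2_def gaussian_def mult_exp_exp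
    by (simp add: power2_eq_square algebra_simps add_divide_distrib)
  then have "(\<lambda>x. complex_of_real (1 * exp (- ?Q x))) = gaussian3 a b c"
    by (intro ext) (simp only: gaussian3_def)
  ultimately show ?thesis by simp
qed

section \<open>Integrals over the surface\<close>

text \<open>The amplitude vanishes off a compact subset of the surface, so the integrand in the chart is a
  continuous function supported in a compact subset of \<open>\<Omega>\<close>, hence integrable.\<close>

lemma surface_integral:
  assumes \<Omega>: "open \<Omega>" and \<phi>: "smooth_on \<Omega> \<phi>" and \<rho>: "is_amplitude \<Omega> \<phi> \<rho>"
    and G: "continuous_on UNIV G"
  defines "h \<equiv> \<lambda>x. sqrt (1 + (partial_deriv (1, 0) \<phi> x)\<^sup>2 + (partial_deriv (0, 1) \<phi> x)\<^sup>2) *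
      (G (x, \<phi> x) * \<rho> (x, \<phi> x))"
  shows "integrable lborel (\<lambda>x. indicator \<Omega> x *\<^sub>R h x)"
    and "(\<integral>\<xi>. G \<xi> * \<rho> \<xi> \<partial>surface_measure \<Omega> \<phi>) = (\<integral>x. indicator \<Omega> x *\<^sub>R h x \<partial>lborel)"
proof -
  let ?J = "\<lambda>x. sqrt (1 + (partial_deriv (1, 0) \<phi> x)\<^sup>2 + (partial_deriv (0, 1) \<phi> x)\<^sup>2)"
  let ?w = "\<lambda>x. \<rho> (x, \<phi> x)"
  let ?R = "restrict_space lborel \<Omega>"
  let ?N = "restrict_space borel (graph_over \<Omega> \<phi>)"
  have c\<phi>: "continuous_on \<Omega> \<phi>"
    using \<phi> by (rule smooth_on_continuous_on)
  have cT: "continuous_on \<Omega> (\<lambda>x. (x, \<phi> x))"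
    by (intro continuous_intros c\<phi>)
  have "continuous_on \<Omega> (partial_deriv (1, 0) \<phi>)" "continuous_on \<Omega> (partial_deriv (0, 1) \<phi>)"
    using smooth_on_continuous_on[OF smooth_on_dir_deriv[OF \<phi>]] by (auto simp: partial_deriv_def)
  then have cJ: "continuous_on \<Omega> ?J"
    by (intro continuous_intros)
  have cw: "continuous_on \<Omega> ?w"
    using \<rho> smooth_on_continuous_on by (auto simp: is_amplitude_def)
  have cG: "continuous_on \<Omega> (\<lambda>x. G (x, \<phi> x))"
    by (rule continuous_on_compose2[OF G cT]) auto
  have ch: "continuous_on \<Omega> h"
    unfolding h_def by (intro continuous_on_mult cJ cG cw)
  have [simp]: "sets ?R = sets (restrict_space borel \<Omega>)" "space ?R = \<Omega>"
    by (auto simp: sets_restrict_space space_restrict_space)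
  have mR: "f \<in> borel_measurable ?R" if "continuous_on \<Omega> f" for f :: "_ \<Rightarrow> 'b::topological_space"
    using borel_measurable_continuous_on_restrict[OF that] by (simp cong: measurable_cong_sets)
  have sp: "space (density ?R f) = \<Omega>" for f by simp
  have T: "(\<lambda>x. (x, \<phi> x)) \<in> measurable (density ?R (\<lambda>x. ennreal (?J x))) ?N"
    using mR[OF cT] by (intro measurable_restrict_space2) (auto simp: graph_over_def)
  have fst: "fst \<in> measurable ?N (restrict_space borel \<Omega>)"
    by (intro measurable_restrict_space2 measurable_restrict_space1)
      (auto simp: graph_over_def space_restrict_space borel_measurable_continuous_onI continuous_on_fst)
  have "(\<lambda>\<xi>. G \<xi> * ?w (fst \<xi>)) \<in> borel_measurable ?N"
    using measurable_restrict_space1[OF borel_measurable_continuous_onI[OF G]]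
      measurable_compose[OF fst borel_measurable_continuous_on_restrict[OF cw]]
    by (rule borel_measurable_times)
  also have "?this \<longleftrightarrow> (\<lambda>\<xi>. G \<xi> * \<rho> \<xi>) \<in> borel_measurable ?N"
    by (intro measurable_cong) (auto simp: graph_over_def space_restrict_space)
  finally have mg: "(\<lambda>\<xi>. G \<xi> * \<rho> \<xi>) \<in> borel_measurable ?N" .
  have "(\<integral>\<xi>. G \<xi> * \<rho> \<xi> \<partial>surface_measure \<Omega> \<phi>) =
      (\<integral>x. G (x, \<phi> x) * ?w x \<partial>density ?R (\<lambda>x. ennreal (?J x)))"
    unfolding surface_measure_def by (rule integral_distr[OF T mg])
  also have "\<dots> = (\<integral>x. ?J x *\<^sub>R (G (x, \<phi> x) * ?w x) \<partial>?R)"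
    using mR[OF cJ] mR[OF continuous_on_mult[OF cG cw]] by (intro integral_density) auto
  also have "\<dots> = (\<integral>x. indicator \<Omega> x *\<^sub>R h x \<partial>lborel)"
    using \<Omega> unfolding h_def by (subst integral_restrict_space) auto
  finally show "(\<integral>\<xi>. G \<xi> * \<rho> \<xi> \<partial>surface_measure \<Omega> \<phi>) = (\<integral>x. indicator \<Omega> x *\<^sub>R h x \<partial>lborel)" .
  obtain A where A: "compact A" "A \<subseteq> graph_over \<Omega> \<phi>" "\<forall>s\<in>graph_over \<Omega> \<phi> - A. \<rho> s = 0"
    using \<rho> by (auto simp: is_amplitude_def)
  have K: "compact (fst ` A)" "fst ` A \<subseteq> \<Omega>"
    using A(1,2) by (auto intro!: compact_continuous_image continuous_on_fst continuous_on_id simp: graph_over_def)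
  have "(\<lambda>x. indicator \<Omega> x *\<^sub>R h x) = (\<lambda>x. indicator (fst ` A) x *\<^sub>R h x)"
  proof
    fix x
    have "h x = 0" if "x \<in> \<Omega>" "x \<notin> fst ` A"
    proof -
      have "(x, \<phi> x) \<in> graph_over \<Omega> \<phi> - A"
        using that by (force simp: graph_over_def)
      then show ?thesis using A(3) by (simp add: h_def)
    qed
    then show "indicator \<Omega> x *\<^sub>R h x = indicator (fst ` A) x *\<^sub>R h x"
      using K(2) by (auto simp: indicator_def)
  qed
  then show "integrable lborel (\<lambda>x. indicator \<Omega> x *\<^sub>R h x)"
    using borel_integrable_compact[OF K(1) continuous_on_subset[OF ch K(2)]] by simp
qed

text \<open>Near \<open>0\<close> the amplitude is bounded below by a positive constant, and the area density is at least \<open>1\<close>.\<close>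

lemma surface_integral_lower_bound:
  assumes \<Omega>: "open \<Omega>" "0 \<in> \<Omega>" and \<phi>: "smooth_on \<Omega> \<phi>" "\<phi> 0 = 0"
    and \<rho>: "is_amplitude \<Omega> \<phi> \<rho>" "\<rho> 0 \<noteq> 0"
  obtains c r where "0 < c" "0 < r" "ball 0 r \<subseteq> \<Omega>"
    "\<forall>G D l. continuous_on UNIV G \<and> (\<forall>\<xi>. 0 \<le> G \<xi>) \<and> D \<in> sets borel \<and> D \<subseteq> ball 0 r \<and> 0 \<le> l \<and>
      (\<forall>x\<in>D. l \<le> G (x, \<phi> x)) \<longrightarrow>
      c * l * measure lborel D \<le> (\<integral>\<xi>. G \<xi> * \<rho> \<xi> \<partial>surface_measure \<Omega> \<phi>)"
proof -
  let ?w = "\<lambda>x. \<rho> (x, \<phi> x)"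
  have w: "0 \<le> ?w x" if "x \<in> \<Omega>" for x
    using \<rho>(1) that by (auto simp: is_amplitude_def graph_over_def)
  define c where "c = ?w 0 / 2"
  have "(0, 0) = (0 :: (real \<times> real) \<times> real)" by (simp add: zero_prod_def)
  then have "?w 0 = \<rho> 0" by (simp only: \<phi>(2))
  then have c: "c > 0" "?w 0 > c"
    using w[OF \<Omega>(2)] \<rho>(2) by (auto simp: c_def)
  have "continuous_on \<Omega> ?w"
    using \<rho>(1) smooth_on_continuous_on by (auto simp: is_amplitude_def)
  then have "open (\<Omega> \<inter> ?w -` {c<..})"
    using \<Omega>(1) by (intro continuous_open_preimage) auto
  then obtain r where r: "r > 0" "ball 0 r \<subseteq> \<Omega> \<inter> ?w -` {c<..}"
    using \<Omega>(2) c(2) openE[of "\<Omega> \<inter> ?w -` {c<..}" 0] by auto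
  show ?thesis
  proof (rule that)
    show "0 < c" "0 < r" "ball 0 r \<subseteq> \<Omega>" using c r by auto
  next
    show "\<forall>G D l. continuous_on UNIV G \<and> (\<forall>\<xi>. 0 \<le> G \<xi>) \<and> D \<in> sets borel \<and> D \<subseteq> ball 0 r \<and> 0 \<le> l \<and>
      (\<forall>x\<in>D. l \<le> G (x, \<phi> x)) \<longrightarrow>
      c * l * measure lborel D \<le> (\<integral>\<xi>. G \<xi> * \<rho> \<xi> \<partial>surface_measure \<Omega> \<phi>)"
    proof (intro allI impI, elim conjE)
      fix G :: "(real \<times> real) \<times> real \<Rightarrow> real" and D l
      assume G: "continuous_on UNIV G" "\<forall>\<xi>. 0 \<le> G \<xi>" and D: "D \<in> sets borel" "D \<subseteq> ball 0 r"
        and l: "0 \<le> l" "\<forall>x\<in>D. l \<le> G (x, \<phi> x)"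
      let ?h = "\<lambda>x. sqrt (1 + (partial_deriv (1, 0) \<phi> x)\<^sup>2 + (partial_deriv (0, 1) \<phi> x)\<^sup>2) *
        (G (x, \<phi> x) * ?w x)"
      have fin: "emeasure lborel D < \<infinity>"
        using emeasure_bounded_finite[OF bounded_subset[OF bounded_ball D(2)]] .
      have "c * l * measure lborel D = (\<integral>x. c * l * indicator D x \<partial>lborel)"
        using D by simp
      also have "\<dots> \<le> (\<integral>x. indicator \<Omega> x *\<^sub>R ?h x \<partial>lborel)"
      proof (rule integral_mono)
        show "integrable lborel (\<lambda>x. c * l * indicator D x)"
          using D fin by (intro integrable_mult_right integrable_real_indicator) auto
        show "integrable lborel (\<lambda>x. indicator \<Omega> x *\<^sub>R ?h x)"
          by (rule surface_integral(1)[OF \<Omega>(1) \<phi>(1) \<rho>(1) G(1)])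
        show "c * l * indicator D x \<le> indicator \<Omega> x *\<^sub>R ?h x" for x
        proof (cases "x \<in> D")
          case True
          then have x: "x \<in> \<Omega>" "c \<le> ?w x" using D r by auto
          have "1 * (l * c) \<le> ?h x"
            using x c l(1) bspec[OF l(2) True] by (intro mult_mono) auto
          then show ?thesis using True x by (simp add: mult.commute)
        next
          case False
          then show ?thesis
            using False spec[OF G(2), of "(x, \<phi> x)"] w[of x] by (cases "x \<in> \<Omega>") simp_all
        qed
      qed
      also have "\<dots> = (\<integral>\<xi>. G \<xi> * \<rho> \<xi> \<partial>surface_measure \<Omega> \<phi>)"
        using surface_integral(2)[OF \<Omega>(1) \<phi>(1) \<rho>(1) G(1)] by simp
      finally show "c * l * measure lborel D \<le> (\<integral>\<xi>. G \<xi> * \<rho> \<xi> \<partial>surface_measure \<Omega> \<phi>)" .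
    qed
  qed
qed

text \<open>The slice over every point of \<open>[-a, a]\<close> is an interval of length \<open>2b\<close>.\<close>

lemma tube_measure:
  fixes \<psi> :: "real \<Rightarrow> real"
  assumes \<psi>: "continuous_on {-a..a} \<psi>" and "0 \<le> a" "0 \<le> b"
  defines "D \<equiv> {x. \<bar>fst x\<bar> \<le> a \<and> \<bar>snd x - \<psi> (fst x)\<bar> \<le> b}"
  shows "D \<in> sets borel" "measure lborel D = 4 * (a * b)"
proof -
  have "closed (({-a..a} \<times> UNIV) \<inter> (\<lambda>x. \<bar>snd x - \<psi> (fst x)\<bar>) -` {..b})"
    by (intro continuous_closed_preimage continuous_intros continuous_on_compose2[OF \<psi>] closed_Times) auto
  also have "({-a..a} \<times> UNIV) \<inter> (\<lambda>x. \<bar>snd x - \<psi> (fst x)\<bar>) -` {..b} = D"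
    by (auto simp: D_def)
  finally show D: "D \<in> sets borel" by simp
  have slice: "Pair x -` D = (if x \<in> {-a..a} then {\<psi> x - b..\<psi> x + b} else {})" for x
    by (auto simp: D_def)
  have "emeasure lborel D = emeasure (lborel \<Otimes>\<^sub>M lborel) D"
    by (simp add: lborel_prod)
  also have "\<dots> = (\<integral>\<^sup>+x. emeasure lborel (Pair x -` D) \<partial>lborel)"
    using D by (intro lborel.emeasure_pair_measure_alt) (simp only: lborel_prod sets_lborel)
  also have "\<dots> = (\<integral>\<^sup>+x. ennreal (2 * b) * indicator {-a..a} x \<partial>lborel)"
    unfolding slice using assms(3) by (intro nn_integral_cong) auto
  also have "\<dots> = ennreal (4 * (a * b))"
    using assms(2,3) by (simp add: nn_integral_cmult flip: ennreal_mult)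
  finally show "measure lborel D = 4 * (a * b)"
    using assms(2,3) by (simp add: measure_def)
qed

section \<open>The Knapp example\<close>

lemma powr_exponent_le:
  assumes "0 < c" "\<forall>\<^sub>F \<epsilon> in at_right 0. c * \<epsilon> powr A \<le> C * \<epsilon> powr B"
  shows "B \<le> (A::real)"
proof (rule ccontr)
  assume "\<not> B \<le> A"
  then have "0 < A - B \<or> 0 < B - A" by linarith
  then have pos: "0 < B - A" using \<open>\<not> B \<le> A\<close> by simp
  have "\<forall>\<^sub>F \<epsilon> in at_right 0. \<epsilon> powr (B - A) < c / (\<bar>C\<bar> + 1)"
    using assms(1) by (intro eventually_powr_less[OF pos]) auto
  with assms(2) eventually_at_right_unit
  have "\<forall>\<^sub>F \<epsilon>::real in at_right 0. False"
  proof eventually_elim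
    case (elim \<epsilon>)
    have "C * \<epsilon> powr B \<le> (\<bar>C\<bar> + 1) * \<epsilon> powr B"
      by (intro mult_right_mono) auto
    then have "c * \<epsilon> powr A \<le> (\<bar>C\<bar> + 1) * \<epsilon> powr B"
      using elim(1) by linarith
    also have "\<epsilon> powr B = \<epsilon> powr (B - A) * \<epsilon> powr A"
      by (simp flip: powr_add)
    finally have "c * \<epsilon> powr A \<le> ((\<bar>C\<bar> + 1) * \<epsilon> powr (B - A)) * \<epsilon> powr A"
      by (simp add: mult.assoc)
    then have "c \<le> (\<bar>C\<bar> + 1) * \<epsilon> powr (B - A)"
      using elim(2) by simp
    moreover have "0 < \<bar>C\<bar> + 1" by simp
    then have "(\<bar>C\<bar> + 1) * \<epsilon> powr (B - A) < c"
      using elim(3) by (simp only: pos_less_divide_eq mult.commute)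
    ultimately show False by simp
  qed
  then show False by simp
qed

lemma gaussian_lower:
  assumes "0 < a" "\<bar>x\<bar> \<le> M * a"
  shows "exp (- M\<^sup>2 / 2) \<le> gaussian (1 / a) x"
proof -
  have "\<bar>1 / a * x\<bar> \<le> M" using assms by (simp add: abs_mult divide_le_eq)
  then have "(1 / a * x)\<^sup>2 \<le> M\<^sup>2" using power_mono[of "\<bar>1 / a * x\<bar>" M 2]
    by (simp only: power2_abs abs_ge_zero)
  then show ?thesis by (simp add: gaussian_def)
qed

text \<open>Above the tube of area \<open>4 \<epsilon>^(u + k)\<close> the Fourier transform of the Gaussian with the scales
  \<open>\<epsilon>^u\<close>, \<open>\<epsilon>^b\<close>, \<open>\<epsilon>\<close> is at least a constant times \<open>\<epsilon>^(- (u + b + 1))\<close>, whereas its mixed norm is at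
  most a constant times \<open>\<epsilon>^(- ((u + b) / p\<^sub>1 + 1 / p\<^sub>3))\<close>. The restriction estimate
  compares the two for all small \<open>\<epsilon>\<close>, hence also the exponents.\<close>

lemma knapp_necessary_condition:
  fixes \<psi> :: "real \<Rightarrow> real"
  assumes \<Omega>: "open \<Omega>" "0 \<in> \<Omega>" and \<phi>: "smooth_on \<Omega> \<phi>" "\<phi> 0 = 0"
    and \<rho>: "is_amplitude \<Omega> \<phi> \<rho>" "\<rho> 0 \<noteq> 0"
    and p: "1 \<le> p1" "1 \<le> p3"
    and restriction: "\<forall>f. schwartz f \<longrightarrow>
           sqrt (\<integral>\<xi>. (cmod (fourier f \<xi>))\<^sup>2 * \<rho> \<xi> \<partial>surface_measure \<Omega> \<phi>) \<le> C0 * mixed_norm p1 p3 f"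
    and \<psi>: "open U" "0 \<in> U" "smooth_on U \<psi>" "\<psi> 0 = 0"
    and uk: "0 < u" "0 < k" "b \<le> k" and B: "0 \<le> B"
    and \<psi>_bound: "\<forall>\<^sub>F \<epsilon> in at_right 0. \<forall>x. \<bar>x\<bar> \<le> \<epsilon> powr u \<longrightarrow> \<bar>\<psi> x\<bar> \<le> B * \<epsilon> powr b"
    and weight: "\<And>\<alpha>. partial_deriv \<alpha> (root_coordinates \<phi> \<psi>) 0 \<noteq> 0 \<Longrightarrow>
      1 \<le> u * real (fst \<alpha>) + k * real (snd \<alpha>)"
  shows "(u + b) * (1 - enn2real (1 / p1)) + (1 - enn2real (1 / p3)) \<le> (u + k) / 2"
proof -
  let ?g = "root_coordinates \<phi> \<psi>"
  let ?q1 = "enn2real (1 / p1)" and ?q3 = "enn2real (1 / p3)"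
  obtain c r where c: "0 < c" and r: "0 < r" "ball 0 r \<subseteq> \<Omega>"
    and lower: "\<forall>G D l. continuous_on UNIV G \<and> (\<forall>\<xi>. 0 \<le> G \<xi>) \<and> D \<in> sets borel \<and> D \<subseteq> ball 0 r \<and> 0 \<le> l \<and>
      (\<forall>x\<in>D. l \<le> G (x, \<phi> x)) \<longrightarrow>
      c * l * measure lborel D \<le> (\<integral>\<xi>. G \<xi> * \<rho> \<xi> \<partial>surface_measure \<Omega> \<phi>)"
    by (rule surface_integral_lower_bound[OF \<Omega> \<phi> \<rho>]) (erule (3) that)
  define T where "T y = (fst y, snd y + \<psi> (fst y))" for y
  \<comment> \<open>Points of \<open>W\<close> are mapped into the ball on which the lower bound for surface integrals holds.\<close>
  define W where "W = (fst -` U) \<inter> T -` ball 0 r"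
  have cU: "continuous_on U \<psi>" using \<psi>(3) by (rule smooth_on_continuous_on)
  have "continuous_on (fst -` U) T"
    unfolding T_def by (intro continuous_intros continuous_on_compose2[OF cU]) auto
  then have W: "open W" "0 \<in> W"
    using \<psi> r(1) by (auto simp: W_def T_def zero_prod_def intro!: continuous_open_preimage open_vimage_fst)
  have "smooth_on W ?g"
    using r(2) by (intro smooth_on_root_coordinates[OF \<Omega>(1) W(1) \<psi>(1,3) \<phi>(1)]) (auto simp: W_def T_def)
  then obtain C where C: "0 \<le> C"
    and g_bound: "\<forall>\<^sub>F \<epsilon> in at_right 0. \<forall>y\<in>scaled_box u k \<epsilon>. \<bar>?g y\<bar> \<le> C * \<epsilon> powr 1"
    using scaled_box_bound[OF W uk(1,2) _ weight] by blast
  obtain K where K: "K \<ge> 0" "\<And>a b c. a > 0 \<Longrightarrow> b > 0 \<Longrightarrow> c > 0 \<Longrightarrow> mixed_norm p1 p3 (gaussian3 a b c)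
    \<le> K * (a * b) powr (- ?q1) * c powr (- ?q3)"
    using mixed_norm_gaussian3_bound[OF p] by blast
  \<comment> \<open>A lower bound for the Fourier transform above the tube, up to a power of \<open>\<epsilon>\<close>: the three
    coordinates there are at most \<open>1\<close>, \<open>1 + B\<close> and \<open>C\<close> times the scales of the Gaussian.\<close>
  define c1 where "c1 = (2 * pi) powr (3/2) * (exp (- 1\<^sup>2 / 2) * exp (- (1 + B)\<^sup>2 / 2) * exp (- C\<^sup>2 / 2))"
  have c1: "c1 > 0" by (simp add: c1_def)
  have "\<forall>\<^sub>F \<epsilon> in at_right 0. 4 * c * c1\<^sup>2 * \<epsilon> powr (u + k - 2 * (u + b + 1))
      \<le> (\<bar>C0\<bar> * K)\<^sup>2 * \<epsilon> powr (- 2 * ((u + b) * ?q1 + ?q3))"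
    using \<psi>_bound g_bound eventually_scaled_box_subset[OF W uk(1,2)] eventually_at_right_unit
  proof eventually_elim
    case (elim \<epsilon>)
    have \<epsilon>: "0 < \<epsilon>" "\<epsilon> < 1" using elim(4) by auto
    define D where "D = {x. \<bar>fst x\<bar> \<le> \<epsilon> powr u \<and> \<bar>snd x - \<psi> (fst x)\<bar> \<le> \<epsilon> powr k}"
    have "t \<in> U" if "t \<in> {- (\<epsilon> powr u)..\<epsilon> powr u}" for t
    proof -
      have "(t, 0) \<in> scaled_box u k \<epsilon>" using that by (auto simp: scaled_box_def)
      then show ?thesis using elim(3) by (auto simp: W_def)
    qed
    then have "continuous_on {- (\<epsilon> powr u)..\<epsilon> powr u} \<psi>"
      by (intro continuous_on_subset[OF cU] subsetI)
    note D = tube_measure[OF this powr_ge_zero powr_ge_zero[of \<epsilon> k], folded D_def]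
    have D_props: "x \<in> ball 0 r" "\<bar>fst x\<bar> \<le> 1 * \<epsilon> powr u" "\<bar>snd x\<bar> \<le> (1 + B) * \<epsilon> powr b"
      "\<bar>\<phi> x\<bar> \<le> C * \<epsilon>" if x: "x \<in> D" for x
    proof -
      let ?y = "(fst x, snd x - \<psi> (fst x))"
      have y: "?y \<in> scaled_box u k \<epsilon>" using x by (auto simp: D_def scaled_box_def)
      have Ty: "T ?y = x" by (simp add: T_def)
      show "x \<in> ball 0 r" using elim(3) y Ty by (auto simp: W_def)
      show "\<bar>fst x\<bar> \<le> 1 * \<epsilon> powr u" using x by (simp add: D_def)
      have "\<epsilon> powr k \<le> \<epsilon> powr b" using \<epsilon> uk(3) by (intro powr_mono') auto
      moreover have "\<bar>\<psi> (fst x)\<bar> \<le> B * \<epsilon> powr b" using elim(1) x by (auto simp: D_def)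
      moreover have "\<bar>snd x - \<psi> (fst x)\<bar> \<le> \<epsilon> powr k" using x by (simp add: D_def)
      ultimately show "\<bar>snd x\<bar> \<le> (1 + B) * \<epsilon> powr b" by (simp add: algebra_simps)
      have "?g ?y = \<phi> x" by (simp add: root_coordinates_def)
      then show "\<bar>\<phi> x\<bar> \<le> C * \<epsilon>" using bspec[OF elim(2) y] \<epsilon> by simp
    qed
    let ?f = "gaussian3 (\<epsilon> powr u) (\<epsilon> powr b) \<epsilon>"
    let ?l = "(c1 / (\<epsilon> powr (u + b + 1)))\<^sup>2"
    have scale: "\<epsilon> powr u * \<epsilon> powr b * \<epsilon> = \<epsilon> powr (u + b + 1)"
      using \<epsilon> by (simp add: powr_add)
    have pos: "\<epsilon> powr u > 0" "\<epsilon> powr b > 0" using \<epsilon> by auto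
    have F: "fourier ?f \<xi> = complex_of_real ((2 * pi) powr (3/2) / \<epsilon> powr (u + b + 1) *
      (gaussian (1 / \<epsilon> powr u) (fst (fst \<xi>)) * gaussian (1 / \<epsilon> powr b) (snd (fst \<xi>)) * gaussian (1 / \<epsilon>) (snd \<xi>)))" for \<xi>
      using fourier_gaussian3[OF pos \<epsilon>(1), of \<xi>] unfolding scale gaussian2_def .
    have "continuous_on UNIV (\<lambda>\<xi>. (cmod (fourier ?f \<xi>))\<^sup>2)"
      unfolding F gaussian_def using \<epsilon> by (intro continuous_intros) auto
    moreover have "?l \<le> (cmod (fourier ?f (x, \<phi> x)))\<^sup>2" if x: "x \<in> D" for x
    proof -
      have "c1 / \<epsilon> powr (u + b + 1) = (2 * pi) powr (3/2) / \<epsilon> powr (u + b + 1) *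
          (exp (- 1\<^sup>2 / 2) * exp (- (1 + B)\<^sup>2 / 2) * exp (- C\<^sup>2 / 2))"
        by (simp add: c1_def)
      also have "\<dots> \<le> (2 * pi) powr (3/2) / \<epsilon> powr (u + b + 1) *
          (gaussian (1 / \<epsilon> powr u) (fst x) * gaussian (1 / \<epsilon> powr b) (snd x) * gaussian (1 / \<epsilon>) (\<phi> x))"
        using D_props[OF x] \<epsilon> pos gaussian_pos
        by (intro mult_left_mono mult_mono gaussian_lower) (auto simp: less_imp_le)
      also have "\<dots> \<le> cmod (fourier ?f (x, \<phi> x))"
        unfolding F norm_of_real fst_conv snd_conv by (rule abs_ge_self)
      finally show ?thesis
        using c1 \<epsilon> by (intro power_mono) auto
    qed
    ultimately have "c * ?l * measure lborel D \<le>
        (\<integral>\<xi>. (cmod (fourier ?f \<xi>))\<^sup>2 * \<rho> \<xi> \<partial>surface_measure \<Omega> \<phi>)" (is "_ \<le> ?I")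
      using D(1) D_props(1) by (intro lower[rule_format]) auto
    moreover have "?I \<le> (\<bar>C0\<bar> * (K * (\<epsilon> powr u * \<epsilon> powr b) powr (- ?q1) * \<epsilon> powr (- ?q3)))\<^sup>2"
    proof -
      have nn: "0 \<le> mixed_norm p1 p3 ?f"
        unfolding mixed_norm_def by (rule lp_norm_nonneg)
      have "sqrt ?I \<le> C0 * mixed_norm p1 p3 ?f"
        using pos \<epsilon> by (intro restriction[rule_format] schwartz_gaussian3) auto
      also have "\<dots> \<le> \<bar>C0\<bar> * mixed_norm p1 p3 ?f"
        using nn by (intro mult_right_mono) auto
      also have "\<dots> \<le> \<bar>C0\<bar> * (K * (\<epsilon> powr u * \<epsilon> powr b) powr (- ?q1) * \<epsilon> powr (- ?q3))"
        using K(2)[OF pos \<epsilon>(1)] by (intro mult_left_mono) auto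
      finally show ?thesis by (rule sqrt_le_D)
    qed
    ultimately have "c * ?l * measure lborel D \<le>
        (\<bar>C0\<bar> * (K * (\<epsilon> powr u * \<epsilon> powr b) powr (- ?q1) * \<epsilon> powr (- ?q3)))\<^sup>2"
      by linarith
    moreover have "c * ?l * measure lborel D = 4 * c * c1\<^sup>2 * \<epsilon> powr (u + k - 2 * (u + b + 1))"
    proof -
      have "\<epsilon> powr (u + k - 2 * (u + b + 1)) = \<epsilon> powr u * \<epsilon> powr k / (\<epsilon> powr (u + b + 1) * \<epsilon> powr (u + b + 1))"
        by (simp flip: powr_add powr_diff)
      then show ?thesis
        unfolding D(2) by (simp add: power2_eq_square)
    qed
    moreover have "(\<bar>C0\<bar> * (K * (\<epsilon> powr u * \<epsilon> powr b) powr (- ?q1) * \<epsilon> powr (- ?q3)))\<^sup>2 =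
        (\<bar>C0\<bar> * K)\<^sup>2 * \<epsilon> powr (- 2 * ((u + b) * ?q1 + ?q3))"
    proof -
      have "(\<epsilon> powr u * \<epsilon> powr b) powr (- ?q1) * \<epsilon> powr (- ?q3) = \<epsilon> powr (- ((u + b) * ?q1 + ?q3))"
        by (simp add: powr_powr algebra_simps flip: powr_add)
      moreover have "(\<epsilon> powr (- ((u + b) * ?q1 + ?q3)))\<^sup>2 = \<epsilon> powr (- 2 * ((u + b) * ?q1 + ?q3))"
        by (simp add: power2_eq_square algebra_simps flip: powr_add)
      ultimately show ?thesis
        by (simp only: power_mult_distrib mult.assoc)
    qed
    ultimately show ?case by simp
  qed
  then have "- 2 * ((u + b) * ?q1 + ?q3) \<le> u + k - 2 * (u + b + 1)"
    using c c1 by (intro powr_exponent_le[of "4 * c * c1\<^sup>2"]) auto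
  then show ?thesis by (simp add: algebra_simps)
qed

lemma ennreal_inverse_inverse: "inverse (inverse x) = (x::ennreal)"
proof (cases x)
  case (real t)
  then show ?thesis by (cases "t = 0") (simp_all add: inverse_ennreal)
qed simp

lemma inverse_holder_conj:
  assumes "1 \<le> p"
  shows "enn2real (1 / holder_conj p) = 1 - enn2real (1 / p)"
proof -
  have "1 / p \<le> 1"
    using assms by (intro divide_le_posI_ennreal) (auto intro: less_le_trans[OF zero_less_one])
  have "1 / holder_conj p = 1 - 1 / p"
    by (simp add: holder_conj_def divide_ennreal_def ennreal_inverse_inverse)
  then show ?thesis
    using \<open>1 / p \<le> 1\<close> by (cases "1 / p") (auto simp: ennreal_minus top_unique simp flip: ennreal_1)
qed

lemma le_of_perturbed:
  fixes a b c d :: real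
  assumes "\<And>\<eta>. 0 < \<eta> \<Longrightarrow> a + \<eta> * b \<le> c + \<eta> * d"
  shows "a \<le> c"
proof (rule tendsto_le)
  show "((\<lambda>\<eta>. c + \<eta> * d) \<longlongrightarrow> c) (at_right 0)" "((\<lambda>\<eta>. a + \<eta> * b) \<longlongrightarrow> a) (at_right 0)"
    by (auto intro!: tendsto_eq_intros)
  show "\<forall>\<^sub>F \<eta> in at_right 0. a + \<eta> * b \<le> c + \<eta> * d"
    using eventually_at_right_unit by eventually_elim (use assms in auto)
qed simp

lemma smooth_on_zero: "smooth_on S (\<lambda>x. 0)"
proof -
  have D: "dir_deriv v (\<lambda>x::'a. 0::'b) = (\<lambda>x. 0)" for v
    by (auto intro!: ext dir_deriv_eq[OF has_derivative_const])
  have "ck_on k S (\<lambda>x::'a. 0::'b)" for k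
    by (induction k) (auto simp: D)
  then show ?thesis by (simp add: smooth_on_def)
qed

text \<open>The asymptotics of the root jet are given on a punctured neighbourhood of \<open>0\<close>; continuity adds
  \<open>\<psi>(0) = 0\<close>.\<close>

lemma root_jet_bound:
  assumes "is_principal_root_jet f \<kappa> \<psi>"
  obtains U B \<delta> m where "open U" "0 \<in> U" "smooth_on U \<psi>" "\<psi> 0 = 0" "0 \<le> B" "0 < \<delta>" "\<delta> \<le> 1"
    "real m = snd \<kappa> / fst \<kappa>" "2 \<le> m" "\<And>x. \<bar>x\<bar> < \<delta> \<Longrightarrow> \<bar>\<psi> x\<bar> \<le> B * \<bar>x\<bar> ^ m"
proof -
  obtain U where U: "open U" "0 \<in> U" "smooth_on U \<psi>"
    using assms by (auto simp: is_principal_root_jet_def)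
  obtain m :: nat and b1 where m: "real m = snd \<kappa> / fst \<kappa>" "2 \<le> m"
    and O: "(\<lambda>x. \<psi> x - b1 * x ^ m) \<in> O[at 0](\<lambda>x. x ^ (m + 1))"
    using assms unfolding is_principal_root_jet_def by blast
  obtain c where c: "c > 0" "\<forall>\<^sub>F x in at 0. norm (\<psi> x - b1 * x ^ m) \<le> c * norm (x ^ (m + 1))"
    using landau_o.bigE[OF O] by blast
  then obtain d where d: "d > 0" "\<And>x. x \<noteq> 0 \<Longrightarrow> \<bar>x\<bar> < d \<Longrightarrow> \<bar>\<psi> x - b1 * x ^ m\<bar> \<le> c * \<bar>x\<bar> ^ (m + 1)"
    by (auto simp: eventually_at power_abs abs_mult)
  define B where "B = \<bar>b1\<bar> + c"
  define \<delta> where "\<delta> = min d 1"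
  have bound: "\<bar>\<psi> x\<bar> \<le> B * \<bar>x\<bar> ^ m" if "x \<noteq> 0" "\<bar>x\<bar> < \<delta>" for x
  proof -
    have "\<bar>\<psi> x\<bar> \<le> \<bar>b1 * x ^ m\<bar> + c * \<bar>x\<bar> ^ (m + 1)"
      using d(2)[OF that(1)] that by (auto simp: \<delta>_def)
    also have "\<bar>x\<bar> ^ (m + 1) \<le> \<bar>x\<bar> ^ m"
      using that by (intro power_decreasing) (auto simp: \<delta>_def)
    finally show ?thesis
      using c(1) by (simp add: B_def abs_mult power_abs algebra_simps)
  qed
  have "isCont \<psi> 0"
    using smooth_on_continuous_on[OF U(3)] U(1,2) by (simp add: continuous_on_eq_continuous_at)
  then have "((\<lambda>x. \<bar>\<psi> x\<bar>) \<longlongrightarrow> \<bar>\<psi> 0\<bar>) (at 0)"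
    by (intro tendsto_intros) (simp add: isCont_def)
  moreover have "((\<lambda>x::real. B * \<bar>x\<bar> ^ m) \<longlongrightarrow> B * \<bar>0\<bar> ^ m) (at 0)"
    by (intro tendsto_intros)
  moreover have "\<forall>\<^sub>F x in at 0. \<bar>\<psi> x\<bar> \<le> B * \<bar>x\<bar> ^ m"
    using bound d(1) by (auto simp: eventually_at \<delta>_def intro!: exI[of _ \<delta>])
  ultimately have "\<bar>\<psi> 0\<bar> \<le> B * \<bar>0\<bar> ^ m"
    by (intro tendsto_le[of "at (0::real)"]) auto
  then have \<psi>0: "\<psi> 0 = 0" using m(2) by (simp add: power_0_left split: if_splits)
  show ?thesis
  proof (rule that[OF U \<psi>0 _ _ _ m])
    show "0 \<le> B" "0 < \<delta>" "\<delta> \<le> 1" using c(1) d(1) by (auto simp: B_def \<delta>_def)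
    show "\<bar>\<psi> x\<bar> \<le> B * \<bar>x\<bar> ^ m" if "\<bar>x\<bar> < \<delta>" for x
      using bound[OF _ that] \<psi>0 c(1) by (cases "x = 0") (auto simp: B_def)
  qed
qed

text \<open>If all derivatives of \<open>\<phi>\<close> in the sheared coordinates vanished at \<open>0\<close>, the box estimate would make
  it smaller there than any power of the distance to \<open>0\<close>. The shear changes that distance by at most
  a constant factor, so \<open>\<phi>\<close> itself would be flat at \<open>0\<close> and not of finite type.\<close>

lemma root_coordinates_finite_type:
  assumes \<Omega>: "open \<Omega>" "0 \<in> \<Omega>" and \<phi>: "smooth_on \<Omega> \<phi>" "\<phi> 0 = 0" "finite_type_at \<phi> 0"
    and \<psi>: "open U" "0 \<in> U" "smooth_on U \<psi>" "\<psi> 0 = 0"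
    and lip: "0 \<le> B" "0 < \<delta>" "\<And>x. \<bar>x\<bar> < \<delta> \<Longrightarrow> \<bar>\<psi> x\<bar> \<le> B * \<bar>x\<bar>"
  shows "newton_polyhedron (root_coordinates \<phi> \<psi>) \<noteq> {}"
proof
  let ?g = "root_coordinates \<phi> \<psi>"
  assume "newton_polyhedron ?g = {}"
  then have flat_g: "partial_deriv \<alpha> ?g 0 = 0" for \<alpha>
    using newton_polyhedron_exponent[of \<alpha> ?g] by auto
  define T where "T y = (fst y, snd y + \<psi> (fst y))" for y
  define W where "W = (fst -` U) \<inter> T -` \<Omega>"
  have "continuous_on (fst -` U) T"
    unfolding T_def
    by (intro continuous_intros continuous_on_compose2[OF smooth_on_continuous_on[OF \<psi>(3)]]) auto
  then have W: "open W" "0 \<in> W"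
    using \<psi> \<Omega> by (auto simp: W_def T_def zero_prod_def intro!: continuous_open_preimage open_vimage_fst)
  have g: "smooth_on W ?g"
    by (intro smooth_on_root_coordinates[OF \<Omega>(1) W(1) \<psi>(1,3) \<phi>(1)]) (auto simp: W_def T_def)
  have "\<exists>C. \<forall>\<^sub>F x in nhds 0. \<bar>\<phi> x\<bar> \<le> C * norm x ^ n" for n
  proof -
    obtain C where C: "0 \<le> C" "\<forall>\<^sub>F \<epsilon> in at_right 0. \<forall>y\<in>scaled_box 1 1 \<epsilon>. \<bar>?g y\<bar> \<le> C * \<epsilon> powr (real n)"
      using scaled_box_bound[OF W zero_less_one zero_less_one g, of "real n"] flat_g by blast
    then obtain e where e: "e > 0"
      "\<And>\<epsilon> y. 0 < \<epsilon> \<Longrightarrow> \<epsilon> < e \<Longrightarrow> y \<in> scaled_box 1 1 \<epsilon> \<Longrightarrow> \<bar>?g y\<bar> \<le> C * \<epsilon> powr (real n)"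
      by (auto simp: eventually_at_right_field)
    define d where "d = min \<delta> (e / (1 + B))"
    have d: "d > 0" using e(1) lip by (simp add: d_def)
    have "\<bar>\<phi> x\<bar> \<le> C * (1 + B) ^ n * norm x ^ n" if x: "norm x < d" for x
    proof (cases "x = 0")
      case True
      then show ?thesis using C(1) \<phi>(2) lip(1) by simp
    next
      case False
      let ?\<epsilon> = "(1 + B) * norm x"
      let ?y = "(fst x, snd x - \<psi> (fst x))"
      have n: "\<bar>fst x\<bar> \<le> norm x" "\<bar>snd x\<bar> \<le> norm x"
        using norm_fst_le[of "fst x" "snd x"] norm_snd_le[of "snd x" "fst x"] by auto
      have \<epsilon>: "0 < ?\<epsilon>" "?\<epsilon> < e"
        using x False lip(1) by (auto simp: d_def less_divide_eq mult.commute intro!: mult_pos_pos)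
      have "\<bar>\<psi> (fst x)\<bar> \<le> B * \<bar>fst x\<bar>"
        using lip(3) n x by (auto simp: d_def)
      also have "\<dots> \<le> B * norm x" using n lip(1) by (intro mult_left_mono) auto
      finally have "\<bar>snd x - \<psi> (fst x)\<bar> \<le> ?\<epsilon>" using n by (simp add: algebra_simps)
      moreover have "norm x \<le> ?\<epsilon>" using lip(1) by (simp add: algebra_simps)
      ultimately have "?y \<in> scaled_box 1 1 ?\<epsilon>"
        using n \<epsilon>(1) by (auto simp: scaled_box_def)
      then have "\<bar>?g ?y\<bar> \<le> C * ?\<epsilon> powr (real n)"
        using e(2) \<epsilon> by blast
      then show ?thesis
        using \<epsilon>(1) by (simp add: root_coordinates_def powr_realpow power_mult_distrib)
    qed
    then have "\<forall>\<^sub>F x in nhds 0. \<bar>\<phi> x\<bar> \<le> C * (1 + B) ^ n * norm x ^ n"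
      using d unfolding eventually_nhds_metric by (intro exI[of _ d]) auto
    then show ?thesis by blast
  qed
  then have "flat_at_0 \<phi>" by (simp add: flat_at_0_def)
  then have "partial_deriv \<alpha> \<phi> 0 = 0" for \<alpha>
    by (rule flat_at_0_imp_partial_deriv_zero[OF \<Omega> \<phi>(1)])
  then show False using \<phi>(3) by (simp add: finite_type_at_def)
qed

theorem theorem1p2:
  fixes \<Omega> :: "(real \<times> real) set"
    and \<phi> :: "real \<times> real \<Rightarrow> real"
    and \<rho> :: "(real \<times> real) \<times> real \<Rightarrow> real"
    and \<kappa> :: "real \<times> real"
    and p1 p3 :: ennreal
  assumes "open \<Omega>" and "0 \<in> \<Omega>"
    and "smooth_on \<Omega> \<phi>"
    and "\<phi> 0 = 0"
    and "partial_deriv (1, 0) \<phi> 0 = 0" and "partial_deriv (0, 1) \<phi> 0 = 0"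
    and "\<forall>x\<in>\<Omega>. finite_type_at \<phi> x"
    and "is_principal_weight \<phi> \<kappa>"
    \<comment> \<open>\<open>\<kappa>\<^sub>2 / \<kappa>\<^sub>1 \<ge> 1\<close>, with the quotient read as \<open>\<infinity>\<close> if \<open>\<kappa>\<^sub>1 = 0\<close>\<close>
    and "fst \<kappa> \<le> snd \<kappa>"
    and "adapted \<phi> \<or> (linearly_adapted \<phi> \<and> \<not> adapted \<phi>)"
    and "is_amplitude \<Omega> \<phi> \<rho>" and "\<rho> 0 \<noteq> 0"
    and "1 \<le> p1" and "1 \<le> p3"
    and "\<exists>C::real. \<forall>f. schwartz f \<longrightarrow>
           sqrt (\<integral>\<xi>. (cmod (fourier f \<xi>))\<^sup>2 * \<rho> \<xi> \<partial>surface_measure \<Omega> \<phi>)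
             \<le> C * mixed_norm p1 p3 f"
  shows "(adapted \<phi> \<longrightarrow>
            1 / newton_distance \<phi> * enn2real (1 / holder_conj p1) + enn2real (1 / holder_conj p3)
              \<le> 1 / (2 * newton_distance \<phi>))
       \<and> (linearly_adapted \<phi> \<and> \<not> adapted \<phi> \<longrightarrow>
            (\<forall>\<psi> K m. is_principal_root_jet \<phi> \<kappa> \<psi>
               \<and> K = support_function (augmented_newton_polyhedron \<kappa> (root_coordinates \<phi> \<psi>))
               \<and> m = snd \<kappa> / fst \<kappa>
               \<longrightarrow> ereal (enn2real (1 / holder_conj p3))
                   \<le> - (1 / 2) * legendre (fst \<kappa>) K
                        ((2 + 2 * m) * enn2real (1 / holder_conj p1) - 1)))"
proof -
  let ?P1 = "enn2real (1 / holder_conj p1)" and ?P3 = "enn2real (1 / holder_conj p3)"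
  obtain C0 where C0: "\<forall>f. schwartz f \<longrightarrow>
      sqrt (\<integral>\<xi>. (cmod (fourier f \<xi>))\<^sup>2 * \<rho> \<xi> \<partial>surface_measure \<Omega> \<phi>) \<le> C0 * mixed_norm p1 p3 f"
    using assms(15) by blast
  note knapp = knapp_necessary_condition[OF assms(1-4,11-14) C0,
      folded inverse_holder_conj[OF assms(13)] inverse_holder_conj[OF assms(14)]]
  have \<kappa>: "0 \<le> fst \<kappa>" "0 \<le> snd \<kappa>"
    using assms(8) by (auto simp: is_principal_weight_def)
  show ?thesis
  proof (intro conjI impI allI)
    let ?s = "fst \<kappa> + snd \<kappa>"
    have root0: "root_coordinates \<phi> (\<lambda>_. 0) = \<phi>"
      by (auto simp: root_coordinates_def)
    \<comment> \<open>Both components of \<open>\<kappa>\<close> are increased by \<open>\<eta>\<close>, as the first one may be \<open>0\<close>.\<close>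
    have "(?s * ?P1 + ?P3) + \<eta> * (2 * ?P1) \<le> ?s / 2 + \<eta> * 1" if "0 < \<eta>" for \<eta>
    proof -
      have w: "1 \<le> (fst \<kappa> + \<eta>) * real (fst \<alpha>) + (snd \<kappa> + \<eta>) * real (snd \<alpha>)"
        if "partial_deriv \<alpha> \<phi> 0 \<noteq> 0" for \<alpha>
      proof -
        have "1 \<le> fst \<kappa> * real (fst \<alpha>) + snd \<kappa> * real (snd \<alpha>)"
          using principal_weight(2)[OF assms(8) newton_polyhedron_exponent[OF that]] by simp
        moreover have "0 \<le> \<eta> * real (fst \<alpha>) + \<eta> * real (snd \<alpha>)"
          using \<open>0 < \<eta>\<close> by simp
        ultimately show ?thesis by (simp add: algebra_simps)
      qed
      have "((fst \<kappa> + \<eta>) + (snd \<kappa> + \<eta>)) * ?P1 + ?P3 \<le> ((fst \<kappa> + \<eta>) + (snd \<kappa> + \<eta>)) / 2"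
        by (rule knapp[of UNIV "\<lambda>_. 0" _ _ _ 0])
          (use \<kappa> \<open>0 < \<eta>\<close> w in \<open>auto simp: smooth_on_zero root0\<close>)
      then show ?thesis by (simp add: field_simps)
    qed
    then have "?s * ?P1 + ?P3 \<le> ?s / 2"
      by (rule le_of_perturbed)
    moreover have "?s = 1 / newton_distance \<phi>"
      using principal_weight(1)[OF assms(8)] by (simp add: eq_divide_eq mult.commute) auto
    ultimately show "1 / newton_distance \<phi> * ?P1 + ?P3 \<le> 1 / (2 * newton_distance \<phi>)"
      by simp
  next
    fix \<psi> K and m :: real
    assume asm: "is_principal_root_jet \<phi> \<kappa> \<psi> \<and>
      K = support_function (augmented_newton_polyhedron \<kappa> (root_coordinates \<phi> \<psi>)) \<and> m = snd \<kappa> / fst \<kappa>"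
    let ?g = "root_coordinates \<phi> \<psi>"
    let ?A = "augmented_newton_polyhedron \<kappa> ?g"
    let ?w = "(2 + 2 * m) * ?P1 - 1"
    obtain U B \<delta> n where \<psi>: "open U" "0 \<in> U" "smooth_on U \<psi>" "\<psi> 0 = 0"
      and B: "0 \<le> B" "0 < \<delta>" "\<delta> \<le> 1" and n: "real n = snd \<kappa> / fst \<kappa>" "2 \<le> n"
      and \<psi>_bound: "\<And>x. \<bar>x\<bar> < \<delta> \<Longrightarrow> \<bar>\<psi> x\<bar> \<le> B * \<bar>x\<bar> ^ n"
      using root_jet_bound asm by blast
    have m: "m = real n" "m \<ge> 2" using asm n by auto
    have \<kappa>1: "0 < fst \<kappa>"
      using \<kappa>(1) m asm by (cases "fst \<kappa> = 0") auto
    have lip: "\<bar>\<psi> x\<bar> \<le> B * \<bar>x\<bar>" if "\<bar>x\<bar> < \<delta>" for x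
    proof -
      have "\<bar>x\<bar> ^ n \<le> \<bar>x\<bar> ^ 1"
        using that B n(2) by (intro power_decreasing) auto
      then have "B * \<bar>x\<bar> ^ n \<le> B * \<bar>x\<bar>" using B(1) by (intro mult_left_mono) auto
      then show ?thesis using \<psi>_bound[OF that] by linarith
    qed
    have ne: "newton_polyhedron ?g \<noteq> {}"
      using root_coordinates_finite_type[OF assms(1-4) _ \<psi> B(1,2) lip] assms(2,7) by blast
    have key: "?w * u + 2 * ?P3 \<le> k"
      if u: "0 \<le> u" and k: "0 \<le> k" and sup: "is_supporting_weight (u, k) ?A" for u k
    proof -
      note below = supporting_weight_below[OF sup u k newton_polyhedron_subset_augmented ne]
      have "u * snd \<kappa> \<le> k * fst \<kappa>"
        using augmented_weight_slope[OF \<kappa>1 below] .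
      then have "(m * u) * fst \<kappa> \<le> k * fst \<kappa>"
        using asm \<kappa>1 by (simp add: mult.commute[of u])
      then have slope: "m * u \<le> k"
        using \<kappa>1 by (rule mult_right_le_imp_le)
      \<comment> \<open>The perturbation \<open>(\<eta>, m \<eta>)\<close> makes the weight positive and keeps the slope condition.\<close>
      have "((1 + m) * u * ?P1 + ?P3) + \<eta> * ((1 + m) * ?P1) \<le> (u + k) / 2 + \<eta> * ((1 + m) / 2)"
        if \<eta>: "0 < \<eta>" for \<eta>
      proof -
        have w: "1 \<le> (u + \<eta>) * real (fst \<alpha>) + (k + m * \<eta>) * real (snd \<alpha>)"
          if "partial_deriv \<alpha> ?g 0 \<noteq> 0" for \<alpha>
        proof -
          have "1 \<le> u * real (fst \<alpha>) + k * real (snd \<alpha>)"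
            using below newton_polyhedron_exponent[OF that] newton_polyhedron_subset_augmented by fastforce
          moreover have "0 \<le> \<eta> * real (fst \<alpha>) + m * \<eta> * real (snd \<alpha>)"
            using \<eta> m by simp
          ultimately show ?thesis by (simp add: algebra_simps)
        qed
        have "\<forall>\<^sub>F \<epsilon> in at_right 0. \<epsilon> powr (u + \<eta>) < \<delta>"
          using u \<eta> B by (intro eventually_powr_less) auto
        then have ev: "\<forall>\<^sub>F \<epsilon> in at_right 0. \<forall>x. \<bar>x\<bar> \<le> \<epsilon> powr (u + \<eta>) \<longrightarrow>
            \<bar>\<psi> x\<bar> \<le> B * \<epsilon> powr (m * (u + \<eta>))"
          using eventually_at_right_unit
        proof eventually_elim
          case (elim \<epsilon>)
          show ?case
          proof (intro allI impI)
            fix x assume x: "\<bar>x\<bar> \<le> \<epsilon> powr (u + \<eta>)"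
            have "\<bar>\<psi> x\<bar> \<le> B * \<bar>x\<bar> ^ n" using x elim by (intro \<psi>_bound) auto
            also have "\<dots> \<le> B * (\<epsilon> powr (u + \<eta>)) ^ n"
              using B(1) x by (intro mult_left_mono power_mono) auto
            also have "(\<epsilon> powr (u + \<eta>)) ^ n = \<epsilon> powr (m * (u + \<eta>))"
              using elim by (simp add: m(1) powr_powr mult.commute flip: powr_realpow)
            finally show "\<bar>\<psi> x\<bar> \<le> B * \<epsilon> powr (m * (u + \<eta>))" .
          qed
        qed
        have "((u + \<eta>) + m * (u + \<eta>)) * ?P1 + ?P3 \<le> ((u + \<eta>) + (k + m * \<eta>)) / 2"
        proof (rule knapp[OF \<psi> _ _ _ B(1) ev w])
          show "0 < u + \<eta>" "m * (u + \<eta>) \<le> k + m * \<eta>"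
            using u \<eta> slope by (auto simp: algebra_simps)
          show "0 < k + m * \<eta>" using k \<eta> m by (auto intro!: add_nonneg_pos)
        qed
        then show ?thesis by (simp add: algebra_simps add_divide_distrib)
      qed
      then have "(1 + m) * u * ?P1 + ?P3 \<le> (u + k) / 2"
        by (rule le_of_perturbed)
      then show ?thesis by (simp add: algebra_simps)
    qed
    have "legendre (fst \<kappa>) K ?w \<le> ereal (- 2 * ?P3)"
      unfolding legendre_def
    proof (rule SUP_least)
      fix u assume u: "u \<in> {0..fst \<kappa>}"
      have "ereal (?w * u + 2 * ?P3) \<le> K u"
        using asm u key by (auto simp: support_function_def intro!: Inf_greatest)
      then show "ereal (?w * u) - K u \<le> ereal (- 2 * ?P3)"
        by (cases "K u") auto
    qed
    then show "ereal ?P3 \<le> - (1 / 2) * legendre (fst \<kappa>) K ?w"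
      by (cases "legendre (fst \<kappa>) K ?w") (auto simp: one_ereal_def numeral_eq_ereal)
  qed
qed

end
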